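(* Let $M>0$ and $k\in(-1,1)$. For the generalized Taub-NUT instanton with scale $M$ and chirality number $k$, asymptotic volume growth of balls is cubic: $$\lim_{R\to\infty}R^{-3}\,\mathrm{Vol}\,B(R)=\frac83\pi^2\frac{1}{\sqrt{2M}}\left(\frac{1}{\sqrt{1-k}}+\frac{1}{\sqrt{1+k}}\right).$$
   Context: Generalized Taub-NUT instanton: for a scale $M>0$ and chirality number $k\in[-1,1]$, $N^4=\mathbb{C}\times\mathbb{C}$ with coordinates $u,v\in[0,\infty)$ and $\theta_1,\theta_2\in[0,\sqrt8\pi)$ periodic (circle $\theta_1$ shrinks at $v=0$, circle $\theta_2$ at $u=0$), moment functions $\varphi^1=\frac{v^2}{\sqrt2M}(1+(1+k)u^2)$, $\varphi^2=\frac{u^2}{\sqrt2M}(1+(1-k)v^2)$, and metric $g_4=g_\Sigma+G^{ij}d\theta_i\otimes d\theta_j$ with $g_\Sigma=\frac2M(1+(1+k)u^2+(1-k)v^2)(du^2+dv^2)$ and $G^{ij}=\langle\nabla\varphi^i,\nabla\varphi^j\rangle_{g_\Sigma}$. $B(R)$ is the geodesic ball of radius $R$ about the origin $u=v=0$. *)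

theory Defs
  imports "HOL-Analysis.Analysis"
begin

section \<open>Length, geodesic distance and volume of a Riemannian metric\<close>

text \<open>
  A metric tensor is a map \<open>g p X Y\<close> (base point, two tangent vectors).  Lengths are extended
  nonnegative reals: the derivative of a \<^const>\<open>valid_path\<close> may be unbounded near the finitely many
  exceptional parameters, and such a path of infinite length must not be assigned length 0.
\<close>

definition curve_length ::
    "('a::real_normed_vector \<Rightarrow> 'a \<Rightarrow> 'a \<Rightarrow> real) \<Rightarrow> (real \<Rightarrow> 'a) \<Rightarrow> ennreal" where
  "curve_length g \<gamma> =
     (\<integral>\<^sup>+t\<in>{0..1}. ennreal (sqrt (g (\<gamma> t) (vector_derivative \<gamma> (at t)) (vector_derivative \<gamma> (at t)))) \<partial>lborel)"

definition geodesic_dist ::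
    "('a::real_normed_vector \<Rightarrow> 'a \<Rightarrow> 'a \<Rightarrow> real) \<Rightarrow> 'a \<Rightarrow> 'a \<Rightarrow> ennreal" where
  "geodesic_dist g p q =
     (INF \<gamma>\<in>{\<gamma>. valid_path \<gamma> \<and> pathstart \<gamma> = p \<and> pathfinish \<gamma> = q}. curve_length g \<gamma>)"

definition geodesic_ball ::
    "('a::real_normed_vector \<Rightarrow> 'a \<Rightarrow> 'a \<Rightarrow> real) \<Rightarrow> 'a \<Rightarrow> real \<Rightarrow> 'a set" where
  "geodesic_ball g p R = {q. geodesic_dist g p q < ennreal R}"

definition frame4 :: "4 \<Rightarrow> complex \<times> complex" where
  "frame4 i = (vector [(1, 0), (\<i>, 0), (0, 1), (0, \<i>)] :: (complex \<times> complex) ^ 4) $ i"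

lemma frame4_simps:
  "frame4 1 = (1, 0)" "frame4 2 = (\<i>, 0)" "frame4 3 = (0, 1)" "frame4 4 = (0, \<i>)"
  by (simp_all add: frame4_def vector_def)

text \<open>The volume density is the root of the Gram determinant in the orthonormal frame \<open>frame4\<close>.\<close>

definition riemannian_measure ::
    "(complex \<times> complex \<Rightarrow> complex \<times> complex \<Rightarrow> complex \<times> complex \<Rightarrow> real)
      \<Rightarrow> (complex \<times> complex) measure" where
  "riemannian_measure g =
     density lborel (\<lambda>p. ennreal (sqrt (det ((\<chi> i j. g p (frame4 i) (frame4 j)) :: real ^ 4 ^ 4))))"

section \<open>The base metric, the moment functions and the matrix \<open>G\<close>\<close>

text \<open>Points of the base are pairs \<open>(u, v)\<close>.\<close>

definition conf_factor :: "real \<Rightarrow> real \<Rightarrow> real \<times> real \<Rightarrow> real" where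
  "conf_factor M k = (\<lambda>(u, v). 2 / M * (1 + (1 + k) * u\<^sup>2 + (1 - k) * v\<^sup>2))"

definition base_metric ::
    "real \<Rightarrow> real \<Rightarrow> real \<times> real \<Rightarrow> real \<times> real \<Rightarrow> real \<times> real \<Rightarrow> real" where
  "base_metric M k p X Y = conf_factor M k p * (fst X * fst Y + snd X * snd Y)"

text \<open>
  As \<open>base_metric\<close> is conformal to \<open>du\<^sup>2 + dv\<^sup>2\<close>, the gradient is the pair of partial
  derivatives divided by the conformal factor.
\<close>

definition base_grad ::
    "real \<Rightarrow> real \<Rightarrow> (real \<times> real \<Rightarrow> real) \<Rightarrow> real \<times> real \<Rightarrow> real \<times> real" where
  "base_grad M k f p =
     (deriv (\<lambda>s. f (s, snd p)) (fst p) / conf_factor M k p,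
      deriv (\<lambda>s. f (fst p, s)) (snd p) / conf_factor M k p)"

definition moment1 :: "real \<Rightarrow> real \<Rightarrow> real \<times> real \<Rightarrow> real" where
  "moment1 M k = (\<lambda>(u, v). v\<^sup>2 / (sqrt 2 * M) * (1 + (1 + k) * u\<^sup>2))"

definition moment2 :: "real \<Rightarrow> real \<Rightarrow> real \<times> real \<Rightarrow> real" where
  "moment2 M k = (\<lambda>(u, v). u\<^sup>2 / (sqrt 2 * M) * (1 + (1 - k) * v\<^sup>2))"

definition grad_product ::
    "real \<Rightarrow> real \<Rightarrow> (real \<times> real \<Rightarrow> real) \<Rightarrow> (real \<times> real \<Rightarrow> real) \<Rightarrow> real \<times> real \<Rightarrow> real" where
  "grad_product M k f h p = base_metric M k p (base_grad M k f p) (base_grad M k h p)"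

section \<open>The four-dimensional metric\<close>

text \<open>
  The coordinates \<open>(u, v, \<theta>\<^sub>1, \<theta>\<^sub>2)\<close> are polar coordinates on \<open>\<complex> \<times> \<complex>\<close>; as the angles have
  period \<open>sqrt 8 * pi\<close>, the usual polar angles are \<open>\<theta>\<^sub>i / sqrt 2\<close>.  The first factor carries
  \<open>(v, \<theta>\<^sub>1)\<close> and the second \<open>(u, \<theta>\<^sub>2)\<close>, so that the \<open>\<theta>\<^sub>1\<close>-circle shrinks at \<open>v = 0\<close>
  and the \<open>\<theta>\<^sub>2\<close>-circle at \<open>u = 0\<close>.
\<close>

definition tn_chart :: "real \<Rightarrow> real \<Rightarrow> real \<Rightarrow> real \<Rightarrow> complex \<times> complex" where
  "tn_chart u v \<theta>1 \<theta>2 = (of_real v * cis (\<theta>1 / sqrt 2), of_real u * cis (\<theta>2 / sqrt 2))"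

definition coord_u :: "complex \<times> complex \<Rightarrow> real" where
  "coord_u p = norm (snd p)"

definition coord_v :: "complex \<times> complex \<Rightarrow> real" where
  "coord_v p = norm (fst p)"

definition form_du :: "complex \<times> complex \<Rightarrow> complex \<times> complex \<Rightarrow> real" where
  "form_du p X = Re (cnj (snd p) * snd X) / norm (snd p)"

definition form_dv :: "complex \<times> complex \<Rightarrow> complex \<times> complex \<Rightarrow> real" where
  "form_dv p X = Re (cnj (fst p) * fst X) / norm (fst p)"

definition form_dtheta1 :: "complex \<times> complex \<Rightarrow> complex \<times> complex \<Rightarrow> real" where
  "form_dtheta1 p X = sqrt 2 * Im (cnj (fst p) * fst X) / (norm (fst p))\<^sup>2"

definition form_dtheta2 :: "complex \<times> complex \<Rightarrow> complex \<times> complex \<Rightarrow> real" where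
  "form_dtheta2 p X = sqrt 2 * Im (cnj (snd p) * snd X) / (norm (snd p))\<^sup>2"

text \<open>The four one-forms above are the differentials of the coordinates of \<open>tn_chart\<close>.\<close>

lemma forms_along_chart:
  assumes pos: "u t > 0" "v t > 0"
    and "(u has_real_derivative u') (at t)" "(v has_real_derivative v') (at t)"
    and "(a has_real_derivative a') (at t)" "(b has_real_derivative b') (at t)"
  obtains Z where
    "((\<lambda>s. tn_chart (u s) (v s) (a s) (b s)) has_vector_derivative Z) (at t)"
    "form_du (tn_chart (u t) (v t) (a t) (b t)) Z = u'"
    "form_dv (tn_chart (u t) (v t) (a t) (b t)) Z = v'"
    "form_dtheta1 (tn_chart (u t) (v t) (a t) (b t)) Z = a'"
    "form_dtheta2 (tn_chart (u t) (v t) (a t) (b t)) Z = b'"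
proof -
  have polar: "((\<lambda>s. of_real (r s) * cis (c s / sqrt 2)) has_vector_derivative
      (of_real r' + \<i> * of_real (r t * c' / sqrt 2)) * cis (c t / sqrt 2)) (at t)"
    if [derivative_intros]: "(r has_real_derivative r') (at t)" "(c has_real_derivative c') (at t)"
    for r c r' c'
  proof -
    define e where "e = (\<lambda>s. c s / sqrt 2)"
    define e' where "e' = c' / sqrt 2"
    have [derivative_intros]: "(e has_real_derivative e') (at t)"
      unfolding e_def e'_def by (intro DERIV_cdivide that)
    have "((\<lambda>s. r s * cos (e s)) has_real_derivative r' * cos (e t) - r t * e' * sin (e t)) (at t)"
      by (auto intro!: derivative_eq_intros)
    moreover have "((\<lambda>s. r s * sin (e s)) has_real_derivative r' * sin (e t) + r t * e' * cos (e t)) (at t)"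
      by (auto intro!: derivative_eq_intros)
    ultimately have "((\<lambda>s. of_real (r s) * cis (e s)) has_vector_derivative
        (of_real r' + \<i> * of_real (r t * e')) * cis (e t)) (at t)"
      by (simp add: has_vector_derivative_complex_iff has_real_derivative_iff_has_vector_derivative
          algebra_simps)
    then show ?thesis
      by (simp add: e_def e'_def)
  qed
  define Z where "Z = ((of_real v' + \<i> * of_real (v t * a' / sqrt 2)) * cis (a t / sqrt 2),
     (of_real u' + \<i> * of_real (u t * b' / sqrt 2)) * cis (b t / sqrt 2))"
  have "((\<lambda>s. tn_chart (u s) (v s) (a s) (b s)) has_vector_derivative Z) (at t)"
    unfolding tn_chart_def Z_def
    by (intro has_vector_derivative_Pair polar assms)
  moreover have *:
    "Re (cnj (of_real r * cis x) * ((of_real p + \<i> * of_real q) * cis x)) = r * p"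
    "Im (cnj (of_real r * cis x) * ((of_real p + \<i> * of_real q) * cis x)) = r * q" for r x p q
  proof -
    have "cnj (of_real r * cis x) * ((of_real p + \<i> * of_real q) * cis x)
        = of_real r * (of_real p + \<i> * of_real q) * (cis (- x) * cis x)"
      by (simp add: cis_cnj mult_ac)
    also have "cis (- x) * cis x = 1"
      by (simp add: cis_mult)
    finally have e: "cnj (of_real r * cis x) * ((of_real p + \<i> * of_real q) * cis x)
        = of_real r * (of_real p + \<i> * of_real q) * 1" .
    show
      "Re (cnj (of_real r * cis x) * ((of_real p + \<i> * of_real q) * cis x)) = r * p"
      "Im (cnj (of_real r * cis x) * ((of_real p + \<i> * of_real q) * cis x)) = r * q"
      unfolding e by simp_all
  qed
  moreover have "norm (of_real r * cis x) = r" if "r > 0" for r x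
    using that by (simp add: norm_mult)
  ultimately show ?thesis
    using pos
    by (intro that)
       (auto simp only: form_du_def form_dv_def form_dtheta1_def form_dtheta2_def tn_chart_def Z_def
          * fst_conv snd_conv power2_eq_square; simp)+
qed

definition tn_metric_polar ::
    "real \<Rightarrow> real \<Rightarrow> complex \<times> complex \<Rightarrow> complex \<times> complex \<Rightarrow> complex \<times> complex \<Rightarrow> real" where
  "tn_metric_polar M k p X Y =
     (let c = (coord_u p, coord_v p);
          G = (\<lambda>f h. grad_product M k f h c)
      in base_metric M k c (form_du p X, form_dv p X) (form_du p Y, form_dv p Y)
         + G (moment1 M k) (moment1 M k) * form_dtheta1 p X * form_dtheta1 p Y
         + G (moment1 M k) (moment2 M k) * form_dtheta1 p X * form_dtheta2 p Y
         + G (moment2 M k) (moment1 M k) * form_dtheta2 p X * form_dtheta1 p Y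
         + G (moment2 M k) (moment2 M k) * form_dtheta2 p X * form_dtheta2 p Y)"

text \<open>
  The polar expression is meaningful only where \<open>u\<close> and \<open>v\<close> are both nonzero; on the two axes the
  metric is its continuous extension, whose existence is shown by \<open>tn_metric_closed_form\<close> below.
\<close>

definition regular_points :: "(complex \<times> complex) set" where
  "regular_points = {p. fst p \<noteq> 0 \<and> snd p \<noteq> 0}"

definition tn_metric ::
    "real \<Rightarrow> real \<Rightarrow> complex \<times> complex \<Rightarrow> complex \<times> complex \<Rightarrow> complex \<times> complex \<Rightarrow> real" where
  "tn_metric M k p X Y =
     (if p \<in> regular_points then tn_metric_polar M k p X Y
      else Lim (at p within regular_points) (\<lambda>q. tn_metric_polar M k q X Y))"

definition tn_closed_form ::
    "real \<Rightarrow> real \<Rightarrow> complex \<times> complex \<Rightarrow> complex \<times> complex \<Rightarrow> complex \<times> complex \<Rightarrow> real" where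
  "tn_closed_form M k p X Y =
     (let P = (1 + k) * (norm (snd p))\<^sup>2;
          Q = (1 - k) * (norm (fst p))\<^sup>2;
          F = 1 + P + Q;
          J1 = (\<lambda>Z. Im (cnj (fst p) * fst Z));
          J2 = (\<lambda>Z. Im (cnj (snd p) * snd Z))
      in 2 / M * (F * (X \<bullet> Y)
          + (((1 + k) * P - 2 * (1 - k) * (1 + P) - (1 - k) * Q) * J1 X * J1 Y
             + ((1 - k) * Q - 2 * (1 + k) * (1 + Q) - (1 + k) * P) * J2 X * J2 Y
             + ((1 + k) * (1 + Q) + (1 - k) * (1 + P)) * (J1 X * J2 Y + J2 X * J1 Y)) / F))"

lemma grad_product_moments:
  fixes M k u v :: real
  defines "F \<equiv> 1 + (1 + k) * u\<^sup>2 + (1 - k) * v\<^sup>2"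
  assumes M: "M > 0" and F: "F > 0"
  shows "grad_product M k (moment1 M k) (moment1 M k) (u, v)
           = v\<^sup>2 * ((1 + (1 + k) * u\<^sup>2)\<^sup>2 + (1 + k)\<^sup>2 * u\<^sup>2 * v\<^sup>2) / (M * F)"
    and "grad_product M k (moment2 M k) (moment2 M k) (u, v)
           = u\<^sup>2 * ((1 + (1 - k) * v\<^sup>2)\<^sup>2 + (1 - k)\<^sup>2 * u\<^sup>2 * v\<^sup>2) / (M * F)"
    and "grad_product M k (moment1 M k) (moment2 M k) (u, v)
           = u\<^sup>2 * v\<^sup>2 * ((1 + k) * (1 + (1 - k) * v\<^sup>2) + (1 - k) * (1 + (1 + k) * u\<^sup>2)) / (M * F)"
    and "grad_product M k (moment2 M k) (moment1 M k) (u, v)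
           = u\<^sup>2 * v\<^sup>2 * ((1 + k) * (1 + (1 - k) * v\<^sup>2) + (1 - k) * (1 + (1 + k) * u\<^sup>2)) / (M * F)"
proof -
  have d: "deriv (\<lambda>s. moment1 M k (s, v)) u = 2 * (1 + k) * u * v\<^sup>2 / (sqrt 2 * M)"
    "deriv (\<lambda>s. moment1 M k (u, s)) v = 2 * v * (1 + (1 + k) * u\<^sup>2) / (sqrt 2 * M)"
    "deriv (\<lambda>s. moment2 M k (s, v)) u = 2 * u * (1 + (1 - k) * v\<^sup>2) / (sqrt 2 * M)"
    "deriv (\<lambda>s. moment2 M k (u, s)) v = 2 * (1 - k) * v * u\<^sup>2 / (sqrt 2 * M)"
  proof -
    have q: "deriv (\<lambda>s. a * s\<^sup>2 + b) x = 2 * a * x" for a b x :: real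
      by (rule DERIV_imp_deriv) (auto intro!: derivative_eq_intros)
    have "(\<lambda>s. moment1 M k (s, v)) = (\<lambda>s. (v\<^sup>2 / (sqrt 2 * M) * (1 + k)) * s\<^sup>2 + v\<^sup>2 / (sqrt 2 * M))"
      "(\<lambda>s. moment1 M k (u, s)) = (\<lambda>s. ((1 + (1 + k) * u\<^sup>2) / (sqrt 2 * M)) * s\<^sup>2 + 0)"
      "(\<lambda>s. moment2 M k (s, v)) = (\<lambda>s. ((1 + (1 - k) * v\<^sup>2) / (sqrt 2 * M)) * s\<^sup>2 + 0)"
      "(\<lambda>s. moment2 M k (u, s)) = (\<lambda>s. (u\<^sup>2 / (sqrt 2 * M) * (1 - k)) * s\<^sup>2 + u\<^sup>2 / (sqrt 2 * M))"
      by (simp_all add: moment1_def moment2_def fun_eq_iff algebra_simps add_divide_distrib diff_divide_distrib)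
    note r = this[THEN arg_cong, of deriv]
    show "deriv (\<lambda>s. moment1 M k (s, v)) u = 2 * (1 + k) * u * v\<^sup>2 / (sqrt 2 * M)"
      "deriv (\<lambda>s. moment1 M k (u, s)) v = 2 * v * (1 + (1 + k) * u\<^sup>2) / (sqrt 2 * M)"
      "deriv (\<lambda>s. moment2 M k (s, v)) u = 2 * u * (1 + (1 - k) * v\<^sup>2) / (sqrt 2 * M)"
      "deriv (\<lambda>s. moment2 M k (u, s)) v = 2 * (1 - k) * v * u\<^sup>2 / (sqrt 2 * M)"
      unfolding r q by (simp_all add: mult_ac)
  qed
  have c: "conf_factor M k (u, v) = 2 / M * F"
    by (simp add: conf_factor_def F_def)
  have e: "2 / M * F * (a / (sqrt 2 * M) / (2 / M * F) * (b / (sqrt 2 * M) / (2 / M * F))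
         + a' / (sqrt 2 * M) / (2 / M * F) * (b' / (sqrt 2 * M) / (2 / M * F)))
      = (a * b + a' * b') / (4 * M * F)" for a b a' b'
  proof -
    have "x / (sqrt 2 * M) / (2 / M * F) * (y / (sqrt 2 * M) / (2 / M * F)) = x * y / (8 * F\<^sup>2)" for x y
      using M F real_sqrt_mult_self[of 2] by (simp add: field_simps power2_eq_square)
    then show ?thesis
      using M F by (simp add: field_simps power2_eq_square)
  qed
  show "grad_product M k (moment1 M k) (moment1 M k) (u, v)
           = v\<^sup>2 * ((1 + (1 + k) * u\<^sup>2)\<^sup>2 + (1 + k)\<^sup>2 * u\<^sup>2 * v\<^sup>2) / (M * F)"
    "grad_product M k (moment2 M k) (moment2 M k) (u, v)
           = u\<^sup>2 * ((1 + (1 - k) * v\<^sup>2)\<^sup>2 + (1 - k)\<^sup>2 * u\<^sup>2 * v\<^sup>2) / (M * F)"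
    "grad_product M k (moment1 M k) (moment2 M k) (u, v)
           = u\<^sup>2 * v\<^sup>2 * ((1 + k) * (1 + (1 - k) * v\<^sup>2) + (1 - k) * (1 + (1 + k) * u\<^sup>2)) / (M * F)"
    "grad_product M k (moment2 M k) (moment1 M k) (u, v)
           = u\<^sup>2 * v\<^sup>2 * ((1 + k) * (1 + (1 - k) * v\<^sup>2) + (1 - k) * (1 + (1 + k) * u\<^sup>2)) / (M * F)"
    unfolding grad_product_def base_metric_def base_grad_def fst_conv snd_conv d c e
    using M F by (simp_all add: frac_eq_eq) (algebra+)
qed

lemma tn_metric_polar_eq_closed_form:
  assumes M: "M > 0" and k: "-1 \<le> k" "k \<le> 1" and p: "p \<in> regular_points"
  shows "tn_metric_polar M k p X Y = tn_closed_form M k p X Y"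
proof -
  obtain z w where [simp]: "p = (z, w)" by (cases p)
  obtain X1 X2 where [simp]: "X = (X1, X2)" by (cases X)
  obtain Y1 Y2 where [simp]: "Y = (Y1, Y2)" by (cases Y)
  define u v where "u = norm w" and "v = norm z"
  have uv: "u > 0" "v > 0"
    using p by (auto simp: regular_points_def u_def v_def)
  define P Q where "P = (1 + k) * u\<^sup>2" and "Q = (1 - k) * v\<^sup>2"
  define F where "F = 1 + P + Q"
  have "P \<ge> 0" "Q \<ge> 0" using k by (auto simp: P_def Q_def)
  then have F: "F > 0" by (simp add: F_def)
  have split: "a \<bullet> b = (Re (cnj c * a) * Re (cnj c * b) + Im (cnj c * a) * Im (cnj c * b)) / (norm c)\<^sup>2"
    if "c \<noteq> 0" for a b c :: complex
  proof -
    have "Re (cnj c * a) * Re (cnj c * b) + Im (cnj c * a) * Im (cnj c * b) = (a \<bullet> b) * (norm c)\<^sup>2"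
      unfolding cmod_power2 inner_complex_def by (simp add: power2_eq_square algebra_simps)
    then show ?thesis using that by simp
  qed
  define R1 R2 S1 S2 where
    "R1 = Re (cnj z * X1)" and "R2 = Re (cnj w * X2)" and
    "S1 = Re (cnj z * Y1)" and "S2 = Re (cnj w * Y2)"
  define I1 I2 J1 J2 where
    "I1 = Im (cnj z * X1)" and "I2 = Im (cnj w * X2)" and
    "J1 = Im (cnj z * Y1)" and "J2 = Im (cnj w * Y2)"
  have inner: "X \<bullet> Y = (R1 * S1 + I1 * J1) / v\<^sup>2 + (R2 * S2 + I2 * J2) / u\<^sup>2"
    using split[of z X1 Y1] split[of w X2 Y2] uv
    by (simp add: u_def v_def R1_def R2_def S1_def S2_def I1_def I2_def J1_def J2_def)
  have sq: "sqrt 2 * a / b * (sqrt 2 * c / d) = 2 * a * c / (b * d)" for a b c d :: real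
    using real_sqrt_mult_self[of 2] by (simp add: field_simps)
  have F': "F = 1 + (1 + k) * u\<^sup>2 + (1 - k) * v\<^sup>2"
    by (simp add: F_def P_def Q_def)
  note G = grad_product_moments[OF M F[unfolded F'], folded F']
  define A where "A = v\<^sup>2 * ((1 + P)\<^sup>2 + (1 + k) * P * v\<^sup>2) / (M * F)"
  define B where "B = u\<^sup>2 * ((1 + Q)\<^sup>2 + (1 - k) * Q * u\<^sup>2) / (M * F)"
  define C where "C = u\<^sup>2 * v\<^sup>2 * ((1 + k) * (1 + Q) + (1 - k) * (1 + P)) / (M * F)"
  have GA: "grad_product M k (moment1 M k) (moment1 M k) (u, v) = A"
    "grad_product M k (moment2 M k) (moment2 M k) (u, v) = B"
    "grad_product M k (moment1 M k) (moment2 M k) (u, v) = C"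
    "grad_product M k (moment2 M k) (moment1 M k) (u, v) = C"
    unfolding G A_def B_def C_def P_def Q_def by (simp_all add: power2_eq_square algebra_simps)
  have conf: "conf_factor M k (u, v) = 2 / M * F"
    by (simp add: conf_factor_def F')
  have "tn_metric_polar M k p X Y = 2 / M * F * (R2 / u * (S2 / u) + R1 / v * (S1 / v))
     + A * (sqrt 2 * I1 / v\<^sup>2 * (sqrt 2 * J1 / v\<^sup>2)) + C * (sqrt 2 * I1 / v\<^sup>2 * (sqrt 2 * J2 / u\<^sup>2))
     + C * (sqrt 2 * I2 / u\<^sup>2 * (sqrt 2 * J1 / v\<^sup>2)) + B * (sqrt 2 * I2 / u\<^sup>2 * (sqrt 2 * J2 / u\<^sup>2))"
    unfolding tn_metric_polar_def Let_def coord_u_def coord_v_def base_metric_def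
      form_du_def form_dv_def form_dtheta1_def form_dtheta2_def
    by (simp add: u_def[symmetric] v_def[symmetric] GA conf
        R1_def[symmetric] R2_def[symmetric] S1_def[symmetric] S2_def[symmetric]
        I1_def[symmetric] I2_def[symmetric] J1_def[symmetric] J2_def[symmetric] mult.assoc
        del: times_complex.sel)
  also have "\<dots> = 2 / M * F * (R2 * S2 / u\<^sup>2 + R1 * S1 / v\<^sup>2)
     + 2 * (A / v\<^sup>2 / v\<^sup>2) * (I1 * J1) + 2 * (C / v\<^sup>2 / u\<^sup>2) * (I1 * J2 + I2 * J1)
     + 2 * (B / u\<^sup>2 / u\<^sup>2) * (I2 * J2)"
    unfolding sq using uv by (simp add: field_simps power2_eq_square)
  also have "A / v\<^sup>2 / v\<^sup>2 = 1 / M * (F / v\<^sup>2 + ((1 + k) * P - 2 * (1 - k) * (1 + P) - (1 - k) * Q) / F)"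
  proof -
    have "F * F + v\<^sup>2 * ((1 + k) * P - 2 * (1 - k) * (1 + P) - (1 - k) * Q)
        = (1 + P)\<^sup>2 + (1 + k) * P * v\<^sup>2"
      unfolding F_def Q_def by algebra
    moreover have "F / v\<^sup>2 + x / F = (F * F + v\<^sup>2 * x) / (v\<^sup>2 * F)" for x
      using uv F by (simp add: field_simps)
    ultimately show ?thesis
      unfolding A_def using uv M F by simp
  qed
  also have "B / u\<^sup>2 / u\<^sup>2 = 1 / M * (F / u\<^sup>2 + ((1 - k) * Q - 2 * (1 + k) * (1 + Q) - (1 + k) * P) / F)"
  proof -
    have "F * F + u\<^sup>2 * ((1 - k) * Q - 2 * (1 + k) * (1 + Q) - (1 + k) * P)
        = (1 + Q)\<^sup>2 + (1 - k) * Q * u\<^sup>2"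
      unfolding F_def P_def by algebra
    moreover have "F / u\<^sup>2 + x / F = (F * F + u\<^sup>2 * x) / (u\<^sup>2 * F)" for x
      using uv F by (simp add: field_simps)
    ultimately show ?thesis
      unfolding B_def using uv M F by simp
  qed
  also have "C / v\<^sup>2 / u\<^sup>2 = 1 / M * (((1 + k) * (1 + Q) + (1 - k) * (1 + P)) / F)"
    unfolding C_def using uv M F by simp
  also have "2 / M * F * (R2 * S2 / u\<^sup>2 + R1 * S1 / v\<^sup>2)
     + 2 * (1 / M * (F / v\<^sup>2 + a / F)) * (I1 * J1) + 2 * (1 / M * (c / F)) * (I1 * J2 + I2 * J1)
     + 2 * (1 / M * (F / u\<^sup>2 + b / F)) * (I2 * J2)
     = 2 / M * (F * (X \<bullet> Y) + (a * I1 * J1 + b * I2 * J2 + c * (I1 * J2 + I2 * J1)) / F)" for a b c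
    unfolding inner by (simp add: algebra_simps add_divide_distrib)
  also have "2 / M * (F * (X \<bullet> Y) + 
      (((1 + k) * P - 2 * (1 - k) * (1 + P) - (1 - k) * Q) * I1 * J1
       + ((1 - k) * Q - 2 * (1 + k) * (1 + Q) - (1 + k) * P) * I2 * J2
       + ((1 + k) * (1 + Q) + (1 - k) * (1 + P)) * (I1 * J2 + I2 * J1)) / F)
     = tn_closed_form M k p X Y"
    unfolding tn_closed_form_def Let_def F_def P_def Q_def u_def v_def I1_def I2_def J1_def J2_def
    by (simp only: fst_conv snd_conv \<open>p = (z, w)\<close> \<open>X = (X1, X2)\<close> \<open>Y = (Y1, Y2)\<close>)
  finally show ?thesis .
qed

lemma closure_regular_points: "closure regular_points = UNIV"
proof -
  have "closure (- {0::complex}) = UNIV"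
    by (simp add: closure_complement)
  moreover have "regular_points = (- {0}) \<times> (- {0})"
    by (auto simp: regular_points_def)
  ultimately have "closure regular_points = closure (- {0::complex}) \<times> closure (- {0::complex})"
    by (metis closure_Times)
  then show ?thesis
    using \<open>closure (- {0}) = UNIV\<close> by (metis UNIV_Times_UNIV)
qed

lemma tn_metric_closed_form:
  assumes M: "M > 0" and k: "-1 \<le> k" "k \<le> 1"
  shows "tn_metric M k p X Y = tn_closed_form M k p X Y"
proof (cases "p \<in> regular_points")
  case True
  then show ?thesis
    using tn_metric_polar_eq_closed_form[OF M k] by (simp add: tn_metric_def)
next
  case False
  have pos: "1 + (1 + k) * (norm (snd q))\<^sup>2 + (1 - k) * (norm (fst q))\<^sup>2 \<noteq> 0" for q :: "complex \<times> complex"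
  proof -
    have "(1 + k) * (norm (snd q))\<^sup>2 \<ge> 0" "(1 - k) * (norm (fst q))\<^sup>2 \<ge> 0"
      using k by auto
    then show ?thesis by linarith
  qed
  have "((\<lambda>q. tn_closed_form M k q X Y) \<longlongrightarrow> tn_closed_form M k p X Y) (at p within regular_points)"
    unfolding tn_closed_form_def Let_def by (intro tendsto_intros pos)
  then have "((\<lambda>q. tn_metric_polar M k q X Y) \<longlongrightarrow> tn_closed_form M k p X Y) (at p within regular_points)"
    by (rule Lim_transform_eventually)
       (auto simp: eventually_at_filter tn_metric_polar_eq_closed_form[OF M k])
  moreover have "at p within regular_points \<noteq> bot"
    using closure_regular_points False by (auto simp: trivial_limit_within closure_def)
  ultimately show ?thesis
    using False by (simp add: tn_metric_def tendsto_Lim)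
qed

end

theory Submission
  imports Defs
begin

text \<open>
  Put \<open>a = sqrt (1 - k)\<close>, \<open>b = sqrt (1 + k)\<close>, \<open>E = a\<^sup>2 v\<^sup>2 + b\<^sup>2 u\<^sup>2\<close>, so that the base metric is
  \<open>(2 / M) (1 + E) (du\<^sup>2 + dv\<^sup>2)\<close>.  The function \<open>S = (a v\<^sup>2 + b u\<^sup>2) / sqrt (2 M)\<close> has gradient of
  norm at most \<open>1\<close>, hence bounds the distance from the origin from below.  Along its gradient lines
  \<open>v = v\<^sub>0 t\<^sup>a\<close>, \<open>u = u\<^sub>0 t\<^sup>b\<close> the estimate \<open>sqrt ((1 + E) E) \<le> E + sqrt E\<close> shows that the length
  exceeds \<open>S\<close> by at most \<open>2 (u + v) / sqrt (2 M)\<close>, which is of order \<open>sqrt S\<close>.  So the ball of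
  radius \<open>R\<close> lies between the sublevel sets \<open>{S < R - C sqrt R}\<close> and \<open>{S < R}\<close>.  The volume density
  is \<open>(4 / M\<^sup>2) (1 + E)\<close>, and since the area measure of \<open>\<complex>\<close> projects under \<open>z \<mapsto> c |z|\<^sup>2\<close> to
  \<open>(pi / c) dx\<close> on the half-line, the volume of a sublevel set is the integral of an affine function
  over a triangle, an explicit cubic polynomial.
\<close>

section \<open>Curve length and geodesic balls\<close>

text \<open>Off a finite set of parameters a valid path is C1, so the speed is continuous there. The
  arbitrary values of \<open>vector_derivative\<close> at the remaining parameters do not matter,
  since changing a function on a countable set preserves Borel measurability. Additivity and
  substitution in \<open>curve_length_join\<close> depend on this.\<close>

lemma curve_length_integrand_measurable:
  fixes g :: "'a::euclidean_space \<Rightarrow> 'a \<Rightarrow> 'a \<Rightarrow> real"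
  assumes valid: "valid_path \<gamma>" and cont: "continuous_on UNIV (\<lambda>(p, X). g p X X)"
  shows "(\<lambda>t. ennreal (sqrt (g (\<gamma> t) (vector_derivative \<gamma> (at t)) (vector_derivative \<gamma> (at t))))
            * indicator {0..1} t) \<in> borel_measurable borel"
    (is "?f \<in> _")
proof -
  obtain S where S: "finite S" and C1: "\<gamma> C1_differentiable_on {0..1} - S"
    and c: "continuous_on {0..1} \<gamma>"
    using valid by (auto simp: valid_path_def piecewise_C1_differentiable_on_def)
  let ?h = "\<lambda>t. sqrt (g (\<gamma> t) (vector_derivative \<gamma> (at t)) (vector_derivative \<gamma> (at t)))"
  have "continuous_on ({0..1} - S) (\<lambda>t. (\<gamma> t, vector_derivative \<gamma> (at t)))"
    using C1 continuous_on_subset[OF c] by (auto simp: C1_differentiable_on_eq intro!: continuous_intros)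
  from continuous_on_compose2[OF cont this] have "continuous_on ({0..1} - S) ?h"
    by (auto intro!: continuous_intros)
  moreover have "{0..1} - S \<in> sets borel"
    using S by (intro sets.Diff borel_closed finite_imp_closed closed_atLeastAtMost)
  ultimately have "(\<lambda>t. indicator ({0..1} - S) t *\<^sub>R ?h t) \<in> borel_measurable borel"
    by (intro borel_measurable_continuous_on_indicator)
  then have m: "(\<lambda>t. ennreal (indicator ({0..1} - S) t *\<^sub>R ?h t)) \<in> borel_measurable borel"
    by simp
  show ?thesis
    by (rule measurable_discrete_difference[OF m, of S])
       (use S in \<open>auto simp: indicator_def intro: countable_finite\<close>)
qed

lemma valid_path_differentiable_off_finite:
  assumes "valid_path \<gamma>"
  obtains S where "finite S"
    "\<And>t. t \<in> {0..1} - S \<Longrightarrow> (\<gamma> has_vector_derivative vector_derivative \<gamma> (at t)) (at t)"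
  using assms
  by (auto simp: valid_path_def piecewise_C1_differentiable_on_def C1_differentiable_on_eq
      vector_derivative_works)

text \<open>Each half of the joined path runs at double speed. By \<open>hom\<close> the integrand
  doubles as well, and the affine substitution on the half interval absorbs this factor. Only
  subadditivity is needed to extend paths by short segments.\<close>

lemma curve_length_join:
  fixes g :: "'a::euclidean_space \<Rightarrow> 'a \<Rightarrow> 'a \<Rightarrow> real"
  assumes \<gamma>: "valid_path \<gamma>" and \<delta>: "valid_path \<delta>"
    and cont: "continuous_on UNIV (\<lambda>(p, X). g p X X)"
    and hom: "\<And>p c X. g p (c *\<^sub>R X) (c *\<^sub>R X) = c\<^sup>2 * g p X X"
  shows "curve_length g (\<gamma> +++ \<delta>) \<le> curve_length g \<gamma> + curve_length g \<delta>"
proof -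
  define f where "f \<gamma> t = ennreal (sqrt (g (\<gamma> t) (vector_derivative \<gamma> (at t)) (vector_derivative \<gamma> (at t))))
      * indicator {0..1} t" for \<gamma> :: "real \<Rightarrow> 'a" and t :: real
  have len: "curve_length g \<gamma> = (\<integral>\<^sup>+t. f \<gamma> t \<partial>lborel)" for \<gamma>
    by (simp add: curve_length_def f_def)
  have [measurable]: "f \<gamma> \<in> borel_measurable borel" "f \<delta> \<in> borel_measurable borel"
    unfolding f_def using curve_length_integrand_measurable[where g = g, OF _ cont] \<gamma> \<delta> by auto
  obtain S where S: "finite S"
    "\<And>t. t \<in> {0..1} - S \<Longrightarrow> (\<gamma> has_vector_derivative vector_derivative \<gamma> (at t)) (at t)"
    using valid_path_differentiable_off_finite[OF \<gamma>] by metis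
  obtain T where T: "finite T"
    "\<And>t. t \<in> {0..1} - T \<Longrightarrow> (\<delta> has_vector_derivative vector_derivative \<delta> (at t)) (at t)"
    using valid_path_differentiable_off_finite[OF \<delta>] by metis
  \<comment> \<open>Parameters where the joined path may fail to be differentiable: the exceptional
    points of both pieces transported to their halves, the junction and the two endpoints.\<close>
  define E where "E = (\<lambda>x. x / 2) ` S \<union> (\<lambda>x. (x + 1) / 2) ` T \<union> {0, 1/2, 1}"
  have E: "finite E" using S T by (simp add: E_def)
  have scale: "ennreal (sqrt (g p (2 *\<^sub>R X) (2 *\<^sub>R X))) = 2 * ennreal (sqrt (g p X X))" for p X
  proof -
    have "sqrt (g p (2 *\<^sub>R X) (2 *\<^sub>R X)) = 2 * sqrt (g p X X)"
      by (simp only: hom real_sqrt_mult) simp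
    then show ?thesis by (metis ennreal_mult' ennreal_numeral zero_le_numeral)
  qed
  \<comment> \<open>For t outside \<open>E\<close> at most one of the two summands is nonzero;
    bounding by the sum avoids splitting the integral at 1/2.\<close>
  have bound: "f (\<gamma> +++ \<delta>) t \<le> 2 * f \<gamma> (0 + 2 * t) + 2 * f \<delta> (-1 + 2 * t)" if "t \<notin> E" for t
  proof -
    have ne: "t \<noteq> 0" "t \<noteq> 1/2" "t \<noteq> 1" using that by (auto simp: E_def)
    consider "t \<notin> {0..1}" | "0 < t" "t < 1/2" | "1/2 < t" "t < 1"
      using ne by (metis atLeastAtMost_iff linorder_neqE_linordered_idom order_le_less)
    then show ?thesis
    proof cases
      case 1
      then show ?thesis by (simp add: f_def)
    next
      case 2
      have "2 * t \<notin> S"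
        using that unfolding E_def by (metis UnI1 image_eqI nonzero_mult_div_cancel_left zero_neq_numeral)
      then have "(\<gamma> has_vector_derivative vector_derivative \<gamma> (at (2 * t))) (at (2 * t))"
        using 2 by (intro S) auto
      moreover have "((\<lambda>t. 2 * t) has_vector_derivative 2) (at t)"
        by (auto intro!: derivative_eq_intros simp: has_vector_derivative_def)
      ultimately have "(\<gamma> \<circ> (\<lambda>t. 2 * t) has_vector_derivative 2 *\<^sub>R vector_derivative \<gamma> (at (2 * t))) (at t)"
        by (intro vector_diff_chain_at)
      then have "((\<gamma> +++ \<delta>) has_vector_derivative 2 *\<^sub>R vector_derivative \<gamma> (at (2 * t))) (at t)"
        by (rule has_vector_derivative_transform_within_open[of _ _ _ "{0<..<1/2}"])
           (use 2 in \<open>auto simp: joinpaths_def\<close>)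
      then have "f (\<gamma> +++ \<delta>) t = 2 * f \<gamma> (2 * t)"
        using 2 by (simp add: f_def vector_derivative_at scale joinpaths_def)
      then show ?thesis by simp
    next
      case 3
      have "-1 + 2 * t \<notin> T"
        using that image_eqI[of t "\<lambda>x. (x + 1) / 2" "-1 + 2 * t" T] by (auto simp: E_def)
      then have "(\<delta> has_vector_derivative vector_derivative \<delta> (at (-1 + 2 * t))) (at (-1 + 2 * t))"
        using 3 by (intro T) auto
      moreover have "((\<lambda>t. -1 + 2 * t) has_vector_derivative 2) (at t)"
        by (auto intro!: derivative_eq_intros simp: has_vector_derivative_def)
      ultimately have "(\<delta> \<circ> (\<lambda>t. -1 + 2 * t) has_vector_derivative 2 *\<^sub>R vector_derivative \<delta> (at (-1 + 2 * t))) (at t)"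
        by (intro vector_diff_chain_at)
      then have "((\<gamma> +++ \<delta>) has_vector_derivative 2 *\<^sub>R vector_derivative \<delta> (at (-1 + 2 * t))) (at t)"
        by (rule has_vector_derivative_transform_within_open[of _ _ _ "{1/2<..<1}"])
           (use 3 in \<open>auto simp: joinpaths_def algebra_simps\<close>)
      moreover have "(\<gamma> +++ \<delta>) t = \<delta> (-1 + 2 * t)"
        using 3 by (simp add: joinpaths_def algebra_simps)
      ultimately have "f (\<gamma> +++ \<delta>) t = 2 * f \<delta> (-1 + 2 * t)"
        using 3 by (simp add: f_def vector_derivative_at scale)
      then show ?thesis by simp
    qed
  qed
  have "AE t in lborel. t \<notin> E"
    using E by (intro AE_not_in finite_imp_null_set_lborel)
  then have "curve_length g (\<gamma> +++ \<delta>) \<le> (\<integral>\<^sup>+t. 2 * f \<gamma> (0 + 2 * t) + 2 * f \<delta> (-1 + 2 * t) \<partial>lborel)"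
    unfolding len by (intro nn_integral_mono_AE) (use bound in \<open>auto elim!: eventually_mono\<close>)
  also have "\<dots> = \<bar>2\<bar> * (\<integral>\<^sup>+t. f \<gamma> (0 + 2 * t) \<partial>lborel) + \<bar>2\<bar> * (\<integral>\<^sup>+t. f \<delta> (-1 + 2 * t) \<partial>lborel)"
    by (subst nn_integral_add) (auto simp: nn_integral_cmult)
  also have "\<dots> = curve_length g \<gamma> + curve_length g \<delta>"
    unfolding len using nn_integral_real_affine[of "f \<gamma>" 2 0] nn_integral_real_affine[of "f \<delta>" 2 "-1"]
    by simp
  finally show ?thesis .
qed

text \<open>Openness is what makes balls Borel: \<^const>\<open>measure\<close> is \<open>0\<close> on non-measurable sets.\<close>

lemma open_geodesic_ball:
  fixes g :: "'a::euclidean_space \<Rightarrow> 'a \<Rightarrow> 'a \<Rightarrow> real"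
  assumes cont: "continuous_on UNIV (\<lambda>(p, X). g p X X)"
    and hom: "\<And>p c X. g p (c *\<^sub>R X) (c *\<^sub>R X) = c\<^sup>2 * g p X X"
  shows "open (geodesic_ball g p R)"
proof (subst open_subopen, intro ballI)
  fix q assume "q \<in> geodesic_ball g p R"
  then obtain \<gamma> where \<gamma>: "valid_path \<gamma>" "pathstart \<gamma> = p" "pathfinish \<gamma> = q"
    and len: "curve_length g \<gamma> < ennreal R"
    by (auto simp: geodesic_ball_def geodesic_dist_def INF_less_iff)
  obtain l where l: "l \<ge> 0" "curve_length g \<gamma> = ennreal l"
    using len by (cases "curve_length g \<gamma>") auto
  \<comment> \<open>Half of the slack below R: a point joined to q by a segment of length at most
    \<open>e\<close> is still in the ball.\<close>
  define e where "e = (R - l) / 2"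
  have e: "e > 0" "l + e < R" "R > 0"
    using len l by (auto simp: e_def field_simps ennreal_less_iff)
  let ?K = "cball q 1 \<times> cball (0::'a) 1"
  have "uniformly_continuous_on ?K (\<lambda>(p, X). g p X X)"
    by (intro compact_uniformly_continuous compact_Times compact_cball continuous_on_subset[OF cont]) auto
  then obtain d where d: "d > 0"
    "\<And>x y. x \<in> ?K \<Longrightarrow> y \<in> ?K \<Longrightarrow> dist y x < d \<Longrightarrow>
       dist ((\<lambda>(p, X). g p X X) y) ((\<lambda>(p, X). g p X X) x) < e\<^sup>2"
    unfolding uniformly_continuous_on_def using zero_less_power[OF e(1), of 2] by blast
  \<comment> \<open>Homogeneity with factor 0 gives \<open>g x 0 0 = 0\<close>, so comparing (x, X)
    with (x, 0) bounds short vectors uniformly for all x near q.\<close>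
  have small: "g x X X < e\<^sup>2" if "dist q x \<le> 1" "norm X \<le> 1" "norm X < d" for x X
    using d(2)[of "(x, 0)" "(x, X)"] hom[of x 0 0] that by (auto simp: dist_Pair_Pair dist_real_def)
  show "\<exists>T. open T \<and> q \<in> T \<and> T \<subseteq> geodesic_ball g p R"
  proof (intro exI conjI subsetI)
    show "open (ball q (min 1 d))" "q \<in> ball q (min 1 d)" using d by auto
    fix x assume x: "x \<in> ball q (min 1 d)"
    have "sqrt (g (linepath q x t) (x - q) (x - q)) \<le> e" if "t \<in> {0..1}" for t
    proof -
      have "linepath q x t - q = t *\<^sub>R (x - q)"
        by (simp add: linepath_def algebra_simps)
      then have "dist q (linepath q x t) = t * dist q x"
        using that by (simp add: dist_norm norm_minus_commute[of q])
      then have "dist q (linepath q x t) \<le> dist q x"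
        using that by (simp add: mult_left_le_one_le)
      then have "g (linepath q x t) (x - q) (x - q) < e\<^sup>2"
        using x by (intro small) (auto simp: dist_norm norm_minus_commute)
      then show ?thesis
        using e by (intro real_le_lsqrt) auto
    qed
    then have "curve_length g (linepath q x) \<le> (\<integral>\<^sup>+t. ennreal e * indicator {0..1::real} t \<partial>lborel)"
      unfolding curve_length_def by (intro nn_integral_mono) (auto simp: indicator_def ennreal_leI)
    also have "\<dots> = ennreal e"
      by (simp add: nn_integral_cmult_indicator)
    finally have "curve_length g \<gamma> + curve_length g (linepath q x) \<le> ennreal l + ennreal e"
      using l by (simp add: add_left_mono)
    with curve_length_join[where g = g, OF \<gamma>(1) valid_path_linepath cont hom, of q x]
    have "curve_length g (\<gamma> +++ linepath q x) \<le> ennreal l + ennreal e"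
      by (rule order_trans)
    also have "\<dots> < ennreal R"
      using e l by (simp add: ennreal_less_iff flip: ennreal_plus)
    finally have "curve_length g (\<gamma> +++ linepath q x) < ennreal R" .
    moreover have "valid_path (\<gamma> +++ linepath q x)"
      using \<gamma> by (intro valid_path_join) auto
    ultimately show "x \<in> geodesic_ball g p R"
      unfolding geodesic_ball_def geodesic_dist_def INF_less_iff mem_Collect_eq
      using \<gamma> by (intro bexI[of _ "\<gamma> +++ linepath q x"]) simp_all
  qed
qed

text \<open>A calibration argument: the derivative of S along the path is at most the speed, and
  integrating it gives the increment of S. This turns any function with gradient of norm at most 1
  into a lower bound for distances.\<close>

lemma curve_length_ge:
  fixes g :: "'a::euclidean_space \<Rightarrow> 'a \<Rightarrow> 'a \<Rightarrow> real" and S :: "'a \<Rightarrow> real"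
  assumes valid: "valid_path \<gamma>"
    and deriv: "\<And>p. (S has_derivative dS p) (at p)"
    and calibrated: "\<And>p X. (dS p X)\<^sup>2 \<le> g p X X"
  shows "ennreal (S (pathfinish \<gamma>) - S (pathstart \<gamma>)) \<le> curve_length g \<gamma>"
proof (cases "curve_length g \<gamma> = \<infinity>")
  case False
  define h where "h t = dS (\<gamma> t) (vector_derivative \<gamma> (at t))" for t
  have le: "\<bar>h t\<bar> \<le> sqrt (g (\<gamma> t) (vector_derivative \<gamma> (at t)) (vector_derivative \<gamma> (at t)))" for t
    using real_sqrt_le_mono[OF calibrated] by (simp add: h_def)
  obtain E where E: "finite E"
    "\<And>t. t \<in> {0..1} - E \<Longrightarrow> (\<gamma> has_vector_derivative vector_derivative \<gamma> (at t)) (at t)"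
    using valid_path_differentiable_off_finite[OF valid] by metis
  have "continuous_on UNIV S"
    using deriv by (meson continuous_at_imp_continuous_on has_derivative_continuous)
  then have c: "continuous_on {0..1} (S \<circ> \<gamma>)"
    using valid by (intro continuous_on_compose) (auto simp: valid_path_def piecewise_C1_differentiable_on_def intro: continuous_on_subset)
  have FTC: "(h has_integral (S \<circ> \<gamma>) 1 - (S \<circ> \<gamma>) 0) {0..1}"
  proof (rule fundamental_theorem_of_calculus_strong[OF E(1) _ _ c])
    fix t assume "t \<in> {0..1} - E"
    from E(2)[OF this] deriv show "((S \<circ> \<gamma>) has_vector_derivative h t) (at t)"
      unfolding h_def o_def by (rule vector_derivative_diff_chain_within[unfolded o_def, OF _ has_derivative_at_withinI])
  qed simp
  have int: "(\<integral>\<^sup>+t. ennreal (norm (indicator {0..1} t *\<^sub>R h t)) \<partial>lborel) \<le> curve_length g \<gamma>"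
    unfolding curve_length_def using le
    by (intro nn_integral_mono) (auto simp: indicator_def ennreal_leI)
  \<comment> \<open>The fundamental theorem yields only a gauge integral, and the path derivative
    may be unbounded. Finite length supplies the absolute integrability that identifies it with the
    Lebesgue integral.\<close>
  have "set_integrable lebesgue {0..1} h"
    unfolding set_integrable_def
  proof (rule integrableI_bounded)
    show "(\<lambda>t. indicator {0..1} t *\<^sub>R h t) \<in> borel_measurable lebesgue"
      by (rule has_integral_implies_lebesgue_measurable[OF FTC])
    show "(\<integral>\<^sup>+t. ennreal (norm (indicator {0..1} t *\<^sub>R h t)) \<partial>lebesgue) < \<infinity>"
      using int False by (simp add: nn_integral_completion less_top order_le_less_trans)
  qed
  then have "(LINT t:{0..1}|lebesgue. h t) = (S \<circ> \<gamma>) 1 - (S \<circ> \<gamma>) 0"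
    and i: "integrable lebesgue (\<lambda>t. indicator {0..1} t *\<^sub>R h t)"
    using FTC by (auto simp: set_lebesgue_integral_eq_integral integral_unique set_integrable_def)
  then have "ennreal (S (pathfinish \<gamma>) - S (pathstart \<gamma>)) \<le> ennreal (norm (LINT t:{0..1}|lebesgue. h t))"
    by (intro ennreal_leI) (simp add: pathfinish_def pathstart_def)
  also have "\<dots> \<le> (\<integral>\<^sup>+t. ennreal (norm (indicator {0..1} t *\<^sub>R h t)) \<partial>lebesgue)"
    unfolding set_lebesgue_integral_def by (rule integral_norm_bound_ennreal[OF i])
  also have "\<dots> \<le> curve_length g \<gamma>"
    using int by (simp add: nn_integral_completion)
  finally show ?thesis .
qed simp

section \<open>Distance from the origin\<close>

lemma continuous_on_tn_metric:
  assumes "M > 0" "-1 \<le> k" "k \<le> 1"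
  shows "continuous_on UNIV (\<lambda>(p, X). tn_metric M k p X X)"
proof -
  have "1 + (1 + k) * (norm (snd q))\<^sup>2 + (1 - k) * (norm (fst q))\<^sup>2 \<noteq> 0" for q :: "complex \<times> complex"
    using assms by (metis add_pos_nonneg diff_ge_0_iff_ge less_irrefl mult_nonneg_nonneg
        add.commute diff_minus_eq_add zero_le_power2 zero_less_one)
  then show ?thesis
    unfolding tn_metric_closed_form[OF assms] tn_closed_form_def Let_def case_prod_beta'
    by (intro continuous_intros) auto
qed

lemma tn_metric_scaleR:
  assumes "M > 0" "-1 \<le> k" "k \<le> 1"
  shows "tn_metric M k p (c *\<^sub>R X) (c *\<^sub>R X) = c\<^sup>2 * tn_metric M k p X X"
proof -
  have e: "m * (F * (c * (c * x)) + (u * (c * y) * (c * y) + v * (c * z) * (c * z)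
      + w * (c * y * (c * z) + c * z * (c * y))) / F)
    = c\<^sup>2 * (m * (F * x + (u * y * y + v * z * z + w * (y * z + z * y)) / F))"
    for m F x y z u v w :: real
    by (simp add: power2_eq_square algebra_simps add_divide_distrib)
  have s: "Im (a * (c *\<^sub>R b)) = c * Im (a * b)" for a b
    by (simp add: algebra_simps)
  show ?thesis
    unfolding tn_metric_closed_form[OF assms] tn_closed_form_def Let_def fst_scaleR snd_scaleR s
      inner_scaleR_left inner_scaleR_right e ..
qed

text \<open>
  This solves the eikonal equation of the base metric with the summand \<open>1\<close> of the conformal factor
  dropped.
\<close>

definition tn_potential :: "real \<Rightarrow> real \<Rightarrow> complex \<times> complex \<Rightarrow> real" where
  "tn_potential M k p =
     (sqrt (1 - k) * (norm (fst p))\<^sup>2 + sqrt (1 + k) * (norm (snd p))\<^sup>2) / sqrt (2 * M)"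

lemma tn_potential_has_derivative:
  "(tn_potential M k has_derivative (\<lambda>X. 2 / sqrt (2 * M) *
      (sqrt (1 - k) * (fst p \<bullet> fst X) + sqrt (1 + k) * (snd p \<bullet> snd X)))) (at p)"
  unfolding tn_potential_def power2_norm_eq_inner
  by (auto intro!: derivative_eq_intros simp: fun_eq_iff inner_commute divide_inverse algebra_simps)

text \<open>Dropping the angular part leaves (2/M) (1 + E) times the squared radial velocity.
  Cauchy-Schwarz bounds the squared differential of the potential by the same expression with E in
  place of 1 + E.\<close>

lemma tn_metric_ge_potential_deriv:
  assumes M: "M > 0" and k: "-1 \<le> k" "k \<le> 1"
  shows "(2 / sqrt (2 * M) * (sqrt (1 - k) * (fst p \<bullet> fst X) + sqrt (1 + k) * (snd p \<bullet> snd X)))\<^sup>2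
           \<le> tn_metric M k p X X" (is "(?d p)\<^sup>2 \<le> _")
proof -
  have regular: "(?d p)\<^sup>2 \<le> tn_metric M k p X X" if p: "p \<in> regular_points" for p
  proof -
    define u v where "u = norm (snd p)" and "v = norm (fst p)"
    have uv: "u > 0" "v > 0"
      using p by (auto simp: regular_points_def u_def v_def)
    define \<rho>1 \<rho>2 a b where "\<rho>1 = form_dv p X" and "\<rho>2 = form_du p X"
      and "a = form_dtheta1 p X" and "b = form_dtheta2 p X"
    have ip: "fst p \<bullet> fst X = v * \<rho>1" "snd p \<bullet> snd X = u * \<rho>2"
      using uv by (auto simp: \<rho>1_def \<rho>2_def form_du_def form_dv_def u_def v_def inner_complex_def)
    define P Q where "P = (1 + k) * u\<^sup>2" and "Q = (1 - k) * v\<^sup>2"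
    have PQ: "P \<ge> 0" "Q \<ge> 0" using k by (auto simp: P_def Q_def)
    have conf: "conf_factor M k (u, v) = 2 / M * (1 + P + Q)"
      by (simp add: conf_factor_def P_def Q_def)
    then have conf_pos: "conf_factor M k (u, v) > 0"
      using M PQ by simp
    \<comment> \<open>G is the Gram matrix of the gradients \<open>x\<close> and \<open>y\<close>,
      so the angular part is the squared base norm of \<open>a x + b y\<close> and hence
      nonnegative.\<close>
    define x where "x = base_grad M k (moment1 M k) (u, v)"
    define y where "y = base_grad M k (moment2 M k) (u, v)"
    have "tn_metric M k p X X = conf_factor M k (u, v) * (\<rho>2 * \<rho>2 + \<rho>1 * \<rho>1)
        + conf_factor M k (u, v) * ((a * fst x + b * fst y)\<^sup>2 + (a * snd x + b * snd y)\<^sup>2)"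
      using p unfolding tn_metric_def tn_metric_polar_def Let_def coord_u_def coord_v_def
        u_def[symmetric] v_def[symmetric] base_metric_def grad_product_def
      by (simp add: x_def[symmetric] y_def[symmetric] \<rho>1_def[symmetric] \<rho>2_def[symmetric]
          a_def[symmetric] b_def[symmetric] power2_eq_square algebra_simps)
    also have "\<dots> \<ge> conf_factor M k (u, v) * (\<rho>2 * \<rho>2 + \<rho>1 * \<rho>1)"
      using conf_pos by simp
    finally have lower: "2 / M * (1 + P + Q) * (\<rho>2 * \<rho>2 + \<rho>1 * \<rho>1) \<le> tn_metric M k p X X"
      by (simp only: conf)
    have "(?d p)\<^sup>2 = 2 / M * (sqrt (1 - k) * v * \<rho>1 + sqrt (1 + k) * u * \<rho>2)\<^sup>2"
    proof -
      have "(2 / sqrt (2 * M))\<^sup>2 = 2 / M" using M by (simp add: power_divide)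
      then show ?thesis
        unfolding ip power_mult_distrib[of "2 / sqrt (2 * M)"] by (simp only: mult.assoc)
    qed
    also have "(sqrt (1 - k) * v * \<rho>1 + sqrt (1 + k) * u * \<rho>2)\<^sup>2
        \<le> ((sqrt (1 - k) * v)\<^sup>2 + (sqrt (1 + k) * u)\<^sup>2) * (\<rho>1\<^sup>2 + \<rho>2\<^sup>2)"
    proof -
      \<comment> \<open>Lagrange's identity, which gives Cauchy-Schwarz in the plane.\<close>
      have "(s * \<rho>1 + t * \<rho>2)\<^sup>2 + (s * \<rho>2 - t * \<rho>1)\<^sup>2 = (s\<^sup>2 + t\<^sup>2) * (\<rho>1\<^sup>2 + \<rho>2\<^sup>2)" for s t
        by algebra
      then show ?thesis by (metis le_add_same_cancel1 zero_le_power2)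
    qed
    also have "(sqrt (1 - k) * v)\<^sup>2 + (sqrt (1 + k) * u)\<^sup>2 = P + Q"
      using k by (simp add: power_mult_distrib P_def Q_def)
    also have "2 / M * ((P + Q) * (\<rho>1\<^sup>2 + \<rho>2\<^sup>2)) \<le> 2 / M * (1 + P + Q) * (\<rho>2 * \<rho>2 + \<rho>1 * \<rho>1)"
    proof -
      have "(P + Q) * (\<rho>1\<^sup>2 + \<rho>2\<^sup>2) \<le> (1 + P + Q) * (\<rho>1\<^sup>2 + \<rho>2\<^sup>2)"
        by (intro mult_right_mono) auto
      moreover have "0 \<le> 2 / M" using M by simp
      ultimately have "2 / M * ((P + Q) * (\<rho>1\<^sup>2 + \<rho>2\<^sup>2)) \<le> 2 / M * ((1 + P + Q) * (\<rho>1\<^sup>2 + \<rho>2\<^sup>2))"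
        by (rule mult_left_mono)
      then show ?thesis
        by (simp only: mult.assoc power2_eq_square add.commute)
    qed
    also note lower
    finally show ?thesis using M by (simp add: divide_right_mono)
  qed
  \<comment> \<open>On the axes the polar forms are meaningless, but both sides are continuous in p,
    so the inequality holds on a closed set that contains the dense regular points.\<close>
  have "continuous_on UNIV (\<lambda>p. tn_metric M k p X X)"
    using continuous_on_compose2[OF continuous_on_tn_metric[OF assms], of UNIV "\<lambda>p. (p, X)"]
    by (simp add: continuous_intros)
  then have "closed {p. (?d p)\<^sup>2 \<le> tn_metric M k p X X}"
    by (intro closed_Collect_le continuous_intros)
  with regular have "closure regular_points \<subseteq> {p. (?d p)\<^sup>2 \<le> tn_metric M k p X X}"
    by (intro closure_minimal) auto
  then show ?thesis
    using closure_regular_points by auto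
qed

lemma geodesic_dist_ge_potential:
  assumes M: "M > 0" and k: "-1 \<le> k" "k \<le> 1"
  shows "ennreal (tn_potential M k q) \<le> geodesic_dist (tn_metric M k) (0, 0) q"
  unfolding geodesic_dist_def
proof (rule INF_greatest, clarify)
  fix \<gamma> :: "real \<Rightarrow> complex \<times> complex"
  assume \<gamma>: "valid_path \<gamma>" "pathstart \<gamma> = (0, 0)"
  have "ennreal (tn_potential M k (pathfinish \<gamma>) - tn_potential M k (pathstart \<gamma>))
      \<le> curve_length (tn_metric M k) \<gamma>"
    by (rule curve_length_ge[OF \<gamma>(1) tn_potential_has_derivative])
       (rule tn_metric_ge_potential_deriv[OF assms])
  moreover have "tn_potential M k (pathstart \<gamma>) = 0"
    by (simp add: \<gamma> tn_potential_def)
  ultimately show "ennreal (tn_potential M k (pathfinish \<gamma>)) \<le> curve_length (tn_metric M k) \<gamma>"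
    by simp
qed

text \<open>The length of one explicit path from the origin to q is estimated by an integrand with
  an elementary antiderivative. Strict bounds on k make both exponents positive, so the path does
  start at the origin.\<close>

lemma geodesic_dist_le_potential:
  assumes M: "M > 0" and k: "-1 < k" "k < 1"
  shows "geodesic_dist (tn_metric M k) (0, 0) q
           \<le> ennreal (tn_potential M k q + 2 / sqrt (2 * M) * (norm (fst q) + norm (snd q)))"
proof -
  obtain z w where q: "q = (z, w)" by (cases q)
  define a b where "a = sqrt (1 - k)" and "b = sqrt (1 + k)"
  have ab: "a > 0" "b > 0" and sq: "a\<^sup>2 = 1 - k" "b\<^sup>2 = 1 + k"
    using k by (auto simp: a_def b_def)
  define \<kappa> where "\<kappa> = 2 / sqrt (2 * M)"
  have \<kappa>: "\<kappa> > 0" "\<kappa>\<^sup>2 = 2 / M"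
    using M by (auto simp: \<kappa>_def power_divide)
  \<comment> \<open>the reparametrised gradient line of \<^const>\<open>tn_potential\<close> through \<open>q\<close>\<close>
  define \<gamma> where "\<gamma> t = ((t powr a) *\<^sub>R z, (t powr b) *\<^sub>R w)" for t :: real
  define v u where "v t = t powr a * norm z" and "u t = t powr b * norm w" for t :: real
  define \<gamma>' where "\<gamma>' t = ((a * t powr (a - 1)) *\<^sub>R z, (b * t powr (b - 1)) *\<^sub>R w)" for t :: real
  have deriv: "(\<gamma> has_vector_derivative \<gamma>' t) (at t)" if "t > 0" for t
    unfolding \<gamma>_def \<gamma>'_def using that
    by (intro has_vector_derivative_Pair has_vector_derivative_scaleR[where g' = 0, simplified]
        has_real_derivative_powr has_vector_derivative_const)
  have powr_cont: "continuous_on {0..1} (\<lambda>t. t powr c)" if "c > 0" for c :: real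
    using that by (intro continuous_on_powr' continuous_intros) auto
  have cont: "continuous_on {0..1} \<gamma>"
    unfolding \<gamma>_def using ab by (intro continuous_intros powr_cont)
  \<comment> \<open>An exponent below 1 can make the velocity blow up at 0, so 0 is taken as an
    exceptional parameter.\<close>
  have "continuous_on ({0..1} - {0}) \<gamma>'"
    unfolding \<gamma>'_def by (intro continuous_intros) auto
  with deriv have "\<gamma> C1_differentiable_on {0..1} - {0}"
    unfolding C1_differentiable_on_def by (intro exI[of _ \<gamma>'] conjI ballI deriv) auto
  with cont have valid: "valid_path \<gamma>"
    unfolding valid_path_def piecewise_C1_differentiable_on_def by blast
  \<comment> \<open>Since \<open>v' = a v / t\<close> and \<open>u' = b u / t\<close>, this is an
    antiderivative of \<open>h\<close>. Its quadratic part at 1 is the potential of q and its linear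
    part is the error term.\<close>
  define H where "H t = \<kappa> * ((a * (v t)\<^sup>2 + b * (u t)\<^sup>2) / 2 + v t + u t)" for t
  define h where "h t = \<kappa> * (((a * v t)\<^sup>2 + (b * u t)\<^sup>2) + a * v t + b * u t) / t" for t
  have vu_deriv: "(v has_real_derivative a * v t / t) (at t)" "(u has_real_derivative b * u t / t) (at t)" if "t > 0" for t
    unfolding v_def u_def using that
    by (auto intro!: derivative_eq_intros simp: powr_diff)
  have vu: "v t \<ge> 0" "u t \<ge> 0" for t by (auto simp: v_def u_def)
  have H: "(h has_integral H 1 - H 0) {0..1}"
  proof (rule fundamental_theorem_of_calculus_strong[of "{0}"])
    fix t :: real assume "t \<in> {0..1} - {0}"
    then have t: "t > 0" by auto
    note [derivative_intros] = vu_deriv[OF t]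
    show "(H has_vector_derivative h t) (at t)"
      unfolding H_def h_def has_real_derivative_iff_has_vector_derivative[symmetric]
      using t by (auto intro!: derivative_eq_intros simp: field_simps power2_eq_square)
  next
    show "continuous_on {0..1} H"
      unfolding H_def v_def u_def
      by (intro powr_cont ab continuous_on_mult continuous_on_add continuous_on_power continuous_on_const continuous_on_divide) auto
  qed auto
  have bound: "sqrt (tn_metric M k (\<gamma> t) (vector_derivative \<gamma> (at t)) (vector_derivative \<gamma> (at t))) \<le> h t"
    if t: "t > 0" for t
  proof -
    define E where "E = (a * v t)\<^sup>2 + (b * u t)\<^sup>2"
    have E: "E \<ge> 0" by (simp add: E_def)
    \<comment> \<open>Each component of the velocity is a real multiple of the same component of the
      position, so the angular terms of the closed form vanish.\<close>
    have im: "Im (cnj (c *\<^sub>R x) * (d *\<^sub>R x)) = 0" for c d x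
      by (simp add: algebra_simps)
    have "vector_derivative \<gamma> (at t) = \<gamma>' t"
      using deriv[OF t] by (rule vector_derivative_at)
    moreover have "\<gamma>' t \<bullet> \<gamma>' t = E / t\<^sup>2"
    proof -
      have n: "(norm ((c * t powr (c - 1)) *\<^sub>R x))\<^sup>2 = (c * (t powr c * norm x))\<^sup>2 / t\<^sup>2" for c and x :: complex
        using t by (simp add: powr_diff power_mult_distrib power_divide)
      show ?thesis
        by (simp only: \<gamma>'_def E_def v_def u_def inner_Pair n[unfolded power2_norm_eq_inner] add_divide_distrib)
    qed
    moreover have "1 + (1 + k) * (norm (snd (\<gamma> t)))\<^sup>2 + (1 - k) * (norm (fst (\<gamma> t)))\<^sup>2 = 1 + E"
      by (simp add: \<gamma>_def E_def v_def u_def sq power_mult_distrib)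
    ultimately have "tn_metric M k (\<gamma> t) (vector_derivative \<gamma> (at t)) (vector_derivative \<gamma> (at t))
        = 2 / M * ((1 + E) * (E / t\<^sup>2))"
      using M k by (simp only: tn_metric_closed_form tn_closed_form_def Let_def less_imp_le)
        (simp add: \<gamma>_def \<gamma>'_def im)
    also have "\<dots> = (\<kappa> / t)\<^sup>2 * ((1 + E) * E)"
      by (simp add: power_divide \<kappa>)
    finally have eq: "sqrt (tn_metric M k (\<gamma> t) (vector_derivative \<gamma> (at t)) (vector_derivative \<gamma> (at t)))
        = \<kappa> / t * sqrt ((1 + E) * E)"
      using \<kappa> t by (simp add: real_sqrt_mult)
    have "sqrt ((1 + E) * E) \<le> E + sqrt E"
      using E by (intro real_le_lsqrt) (auto simp: power2_sum algebra_simps power2_eq_square)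
    also have "sqrt E \<le> a * v t + b * u t"
      using vu ab by (intro real_le_lsqrt) (auto simp: E_def power2_sum)
    finally show ?thesis
      unfolding eq h_def E_def[symmetric] using \<kappa> t
      by (simp add: divide_right_mono mult_left_mono)
  qed
  have "AE t in lborel. ennreal (sqrt (tn_metric M k (\<gamma> t) (vector_derivative \<gamma> (at t)) (vector_derivative \<gamma> (at t))))
      * indicator {0..1} t \<le> ennreal (h t) * indicator {0..1} t"
    using AE_lborel_singleton[of "0::real"]
    by eventually_elim (auto simp: indicator_def intro!: ennreal_leI bound)
  then have "curve_length (tn_metric M k) \<gamma> \<le> (\<integral>\<^sup>+t. ennreal (h t) * indicator {0..1} t \<partial>lborel)"
    unfolding curve_length_def by (rule nn_integral_mono_AE)
  also have "\<dots> = ennreal (H 1 - H 0)"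
    by (rule nn_integral_has_integral_lebesgue'[OF _ H])
       (use \<kappa> ab vu in \<open>auto simp: h_def intro!: divide_nonneg_nonneg add_nonneg_nonneg mult_nonneg_nonneg\<close>)
  also have "H 1 - H 0 = tn_potential M k q + 2 / sqrt (2 * M) * (norm (fst q) + norm (snd q))"
    using ab by (simp add: H_def v_def u_def tn_potential_def q \<kappa>_def a_def[symmetric] b_def[symmetric]
        algebra_simps add_divide_distrib)
  finally have "curve_length (tn_metric M k) \<gamma>
      \<le> ennreal (tn_potential M k q + 2 / sqrt (2 * M) * (norm (fst q) + norm (snd q)))" .
  moreover have "valid_path \<gamma> \<and> pathstart \<gamma> = (0, 0) \<and> pathfinish \<gamma> = q"
    using valid ab by (simp add: pathstart_def pathfinish_def \<gamma>_def q)
  then have "geodesic_dist (tn_metric M k) (0, 0) q \<le> curve_length (tn_metric M k) \<gamma>"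
    unfolding geodesic_dist_def by (intro INF_lower) simp
  ultimately show ?thesis by (rule order_trans[rotated])
qed

section \<open>Volume of sublevel sets\<close>

text \<open>Cofactor expansion along the first row, obtained by peeling one index at a time off the
  Leibniz sum. It serves to evaluate the Gram determinant of \<open>frame4\<close>.\<close>

lemma det_4:
  "det (A::'a::comm_ring_1^4^4) =
    A$1$1 * (A$2$2 * (A$3$3 * A$4$4 - A$3$4 * A$4$3) - A$2$3 * (A$3$2 * A$4$4 - A$3$4 * A$4$2)
              + A$2$4 * (A$3$2 * A$4$3 - A$3$3 * A$4$2))
    - A$1$2 * (A$2$1 * (A$3$3 * A$4$4 - A$3$4 * A$4$3) - A$2$3 * (A$3$1 * A$4$4 - A$3$4 * A$4$1)
              + A$2$4 * (A$3$1 * A$4$3 - A$3$3 * A$4$1))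
    + A$1$3 * (A$2$1 * (A$3$2 * A$4$4 - A$3$4 * A$4$2) - A$2$2 * (A$3$1 * A$4$4 - A$3$4 * A$4$1)
              + A$2$4 * (A$3$1 * A$4$2 - A$3$2 * A$4$1))
    - A$1$4 * (A$2$1 * (A$3$2 * A$4$3 - A$3$3 * A$4$2) - A$2$2 * (A$3$1 * A$4$3 - A$3$3 * A$4$1)
              + A$2$3 * (A$3$1 * A$4$2 - A$3$2 * A$4$1))"
proof -
  have f: "finite {2::4, 3, 4}" "1 \<notin> {2::4, 3, 4}" "finite {3::4, 4}" "2 \<notin> {3::4, 4}"
    "finite {4::4}" "3 \<notin> {4::4}"
    by auto
  show ?thesis
    unfolding det_def UNIV_4
    unfolding sum_over_permutations_insert[OF f(1,2)]
    unfolding sum_over_permutations_insert[OF f(3,4)]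
    unfolding sum_over_permutations_insert[OF f(5,6)]
    unfolding permutes_sing
    by (simp add: sign_swap_id permutation_swap_id permutation_compose sign_compose sign_id swap_id_eq)
       (simp add: algebra_simps)
qed

text \<open>The metric is a multiple of the Euclidean one plus a form built from J1 and J2, which
  are inner products with the orthogonal vectors (iz, 0) and (0, iw). The determinant thus reduces
  to a 2 by 2 one, which collapses to \<open>F\<^sup>2\<close>.\<close>

lemma sqrt_det_tn_metric:
  assumes M: "M > 0" and k: "-1 \<le> k" "k \<le> 1"
  shows "sqrt (det ((\<chi> i j. tn_metric M k p (frame4 i) (frame4 j)) :: real ^ 4 ^ 4))
           = 4 / M\<^sup>2 * (1 + (1 + k) * (norm (snd p))\<^sup>2 + (1 - k) * (norm (fst p))\<^sup>2)"
proof -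
  obtain z w where p: "p = (z, w)" by (cases p)
  define a b c d where "a = Re z" and "b = Im z" and "c = Re w" and "d = Im w"
  have n: "(norm z)\<^sup>2 = a\<^sup>2 + b\<^sup>2" "(norm w)\<^sup>2 = c\<^sup>2 + d\<^sup>2"
    by (simp_all add: a_def b_def c_def d_def cmod_power2)
  define P Q where "P = (1 + k) * (c\<^sup>2 + d\<^sup>2)" and "Q = (1 - k) * (a\<^sup>2 + b\<^sup>2)"
  define F where "F = 1 + P + Q"
  have "P \<ge> 0" "Q \<ge> 0" using k by (auto simp: P_def Q_def)
  then have F: "F > 0" by (simp add: F_def)
  define A where "A = (1 + k) * P - 2 * (1 - k) * (1 + P) - (1 - k) * Q"
  define B where "B = (1 - k) * Q - 2 * (1 + k) * (1 + Q) - (1 + k) * P"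
  define C where "C = (1 + k) * (1 + Q) + (1 - k) * (1 + P)"
  \<comment> \<open>Moving the factor 1/F into \<open>m\<close> leaves entries polynomial in F, A,
    B, C and the coordinates, as \<open>algebra\<close> requires.\<close>
  define m where "m = 2 / (M * F)"
  have ip: "(x :: complex) \<bullet> y = Re x * Re y + Im x * Im y" for x y
    by (simp add: inner_complex_def)
  have g: "tn_metric M k p X Y = m * (F\<^sup>2 * (X \<bullet> Y) + (A * Im (cnj z * fst X) * Im (cnj z * fst Y)
      + B * Im (cnj w * snd X) * Im (cnj w * snd Y)
      + C * (Im (cnj z * fst X) * Im (cnj w * snd Y) + Im (cnj w * snd X) * Im (cnj z * fst Y))))" for X Y
  proof -
    have "2 / M * (F * x + y / F) = m * (F\<^sup>2 * x + y)" for x y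
      using F M by (simp add: m_def field_simps power2_eq_square)
    then show ?thesis
      unfolding tn_metric_closed_form[OF assms] tn_closed_form_def Let_def p fst_conv snd_conv n
        P_def[symmetric] Q_def[symmetric] F_def[symmetric] A_def B_def C_def by metis
  qed
  have "det ((\<chi> i j. tn_metric M k p (frame4 i) (frame4 j)) :: real ^ 4 ^ 4)
      = m ^ 4 * F ^ 4 * ((F\<^sup>2 + A * (a\<^sup>2 + b\<^sup>2)) * (F\<^sup>2 + B * (c\<^sup>2 + d\<^sup>2)) - C\<^sup>2 * (a\<^sup>2 + b\<^sup>2) * (c\<^sup>2 + d\<^sup>2))"
    unfolding det_4
    by (simp add: g frame4_simps inner_Pair ip a_def[symmetric] b_def[symmetric] c_def[symmetric] d_def[symmetric])
       algebra
  also have "\<dots> = m ^ 4 * F ^ 4 * F\<^sup>2"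
  proof -
    have "(F\<^sup>2 + A * (a\<^sup>2 + b\<^sup>2)) * (F\<^sup>2 + B * (c\<^sup>2 + d\<^sup>2)) - C\<^sup>2 * (a\<^sup>2 + b\<^sup>2) * (c\<^sup>2 + d\<^sup>2) = F\<^sup>2"
      unfolding A_def B_def C_def F_def P_def Q_def by algebra
    then show ?thesis by simp
  qed
  also have "\<dots> = (4 / M\<^sup>2 * F)\<^sup>2"
    using F M by (simp add: m_def power_divide power_mult_distrib field_simps)
  finally have "sqrt (det ((\<chi> i j. tn_metric M k p (frame4 i) (frame4 j)) :: real ^ 4 ^ 4)) = 4 / M\<^sup>2 * F"
    using F M by (simp only: real_sqrt_abs) simp
  then show ?thesis
    by (simp add: p n F_def P_def Q_def)
qed

text \<open>The set where \<open>c |z|^2\<close> is at most x is a disc of area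
  \<open>pi x / c\<close> for nonnegative x. So the image of the area measure and the scaled
  Lebesgue measure on the half-line agree on all half-lines.\<close>

lemma nn_integral_complex_norm_squared:
  fixes f :: "real \<Rightarrow> ennreal"
  assumes c: "c > 0" and f [measurable]: "f \<in> borel_measurable borel"
  shows "(\<integral>\<^sup>+z. f (c * (norm (z :: complex))\<^sup>2) \<partial>lborel) = ennreal (pi / c) * (\<integral>\<^sup>+x\<in>{0..}. f x \<partial>lborel)"
proof -
  let ?M = "distr lborel borel (\<lambda>z :: complex. c * (norm z)\<^sup>2)"
  let ?N = "density lborel (\<lambda>x. ennreal (pi / c) * indicator {0..} x) :: real measure"
  have M: "emeasure ?M {..x} = ennreal (pi / c * max x 0)" for x
  proof (cases "x \<ge> 0")
    case True
    have "(\<lambda>z :: complex. c * (norm z)\<^sup>2) -` {..x} = cball 0 (sqrt (x / c))"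
    proof (intro set_eqI)
      fix z :: complex
      have "norm z \<le> sqrt (x / c) \<longleftrightarrow> (norm z)\<^sup>2 \<le> x / c"
        using real_le_lsqrt[of "x / c" "norm z"] real_le_rsqrt[of "norm z" "x / c"] c True
          real_sqrt_le_iff[of "(norm z)\<^sup>2" "x / c"] by simp
      then show "z \<in> (\<lambda>z. c * (norm z)\<^sup>2) -` {..x} \<longleftrightarrow> z \<in> cball 0 (sqrt (x / c))"
        using c by (simp add: field_simps)
    qed
    then show ?thesis
      using c True by (simp add: emeasure_distr emeasure_cball unit_ball_vol_2)
  next
    case False
    then have "(\<lambda>z :: complex. c * (norm z)\<^sup>2) -` {..x} = {}"
      using c by (auto simp: not_le dest: order_le_less_trans) (smt (verit) mult_nonneg_nonneg zero_le_power2)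
    then show ?thesis
      using False by (simp add: emeasure_distr)
  qed
  have N: "emeasure ?N {..x} = ennreal (pi / c * max x 0)" for x
  proof -
    have "emeasure ?N {..x} = (\<integral>\<^sup>+y. ennreal (pi / c) * indicator {0..x} y \<partial>lborel)"
      by (subst emeasure_density) (auto intro!: nn_integral_cong simp: indicator_def)
    also have "\<dots> = ennreal (pi / c) * emeasure lborel {0..x}"
      by (simp add: nn_integral_cmult_indicator)
    also have "\<dots> = ennreal (pi / c * max x 0)"
      using c by (cases "x \<ge> 0") (auto simp flip: ennreal_mult)
    finally show ?thesis .
  qed
  have MN: "?M = ?N"
  \<comment> \<open>The half-lines are closed under intersection, generate the Borel sets, and
    exhaust the line by sets of finite measure.\<close>
  proof (rule measure_eqI_generator_eq[where A = "\<lambda>n. {..real n}" and \<Omega> = UNIV])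
    show "Int_stable (range (atMost :: real \<Rightarrow> _))"
      by (auto simp: Int_stable_def)
    show "(\<Union>n. {..real n}) = UNIV"
      by (auto simp: real_arch_simple)
    have "sets borel = sigma_sets UNIV (range (atMost :: real \<Rightarrow> _))"
      by (subst borel_eq_atMost) simp
    then show "sets ?M = sigma_sets UNIV (range atMost)" "sets ?N = sigma_sets UNIV (range atMost)"
      by simp_all
  qed (auto simp: M N)
  have "(\<integral>\<^sup>+z. f (c * (norm (z :: complex))\<^sup>2) \<partial>lborel) = (\<integral>\<^sup>+x. f x \<partial>?M)"
    by (subst nn_integral_distr) auto
  also have "\<dots> = (\<integral>\<^sup>+x. ennreal (pi / c) * (f x * indicator {0..} x) \<partial>lborel)"
    unfolding MN by (subst nn_integral_density) (auto simp: mult_ac)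
  also have "\<dots> = ennreal (pi / c) * (\<integral>\<^sup>+x\<in>{0..}. f x \<partial>lborel)"
    by (rule nn_integral_cmult) measurable
  finally show ?thesis .
qed

lemma nn_integral_affine_triangle:
  fixes A B T :: real
  assumes AB: "A \<ge> 0" "B \<ge> 0" and T: "T \<ge> 0"
  shows "(\<integral>\<^sup>+x\<in>{0..}. (\<integral>\<^sup>+y\<in>{0..}. ennreal (1 + A * x + B * y) * indicator {..<T} (x + y) \<partial>lborel) \<partial>lborel)
           = ennreal (T\<^sup>2 / 2 + (A + B) * T ^ 3 / 6)"
proof -
  define q where "q x = (1 + A * x) * (T - x) + B * (T - x)\<^sup>2 / 2" for x
  have inner: "(\<integral>\<^sup>+y\<in>{0..}. ennreal (1 + A * x + B * y) * indicator {..<T} (x + y) \<partial>lborel)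
      = ennreal (q x)" if x: "0 \<le> x" "x \<le> T" for x
  proof -
    have "(\<integral>\<^sup>+y\<in>{0..}. ennreal (1 + A * x + B * y) * indicator {..<T} (x + y) \<partial>lborel)
        = (\<integral>\<^sup>+y. ennreal (1 + A * x + B * y) * indicator {0..T - x} y \<partial>lborel)"
      \<comment> \<open>The open triangle omits the endpoint \<open>y = T - x\<close>, a null
        set.\<close>
      by (rule nn_integral_cong_AE, use AE_lborel_singleton[of "T - x"] in eventually_elim)
         (auto simp: indicator_def)
    \<comment> \<open>Left unsimplified as an antiderivative at the upper limit minus its value at
      0, to match the fundamental theorem; the outer integral below is written in the same
      way.\<close>
    also have "\<dots> = ennreal (((1 + A * x) * (T - x) + B * (T - x)\<^sup>2 / 2) - ((1 + A * x) * 0 + B * 0\<^sup>2 / 2))"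
    proof (rule nn_integral_has_integral_lebesgue')
      show "((\<lambda>y. 1 + A * x + B * y) has_integral
          ((1 + A * x) * (T - x) + B * (T - x)\<^sup>2 / 2) - ((1 + A * x) * 0 + B * 0\<^sup>2 / 2)) {0..T - x}"
        using x by (intro fundamental_theorem_of_calculus)
          (auto intro!: derivative_eq_intros simp flip: has_real_derivative_iff_has_vector_derivative)
    qed (use AB x in auto)
    finally show ?thesis by (simp add: q_def)
  qed
  have "(\<integral>\<^sup>+x\<in>{0..}. (\<integral>\<^sup>+y\<in>{0..}. ennreal (1 + A * x + B * y) * indicator {..<T} (x + y) \<partial>lborel) \<partial>lborel)
      = (\<integral>\<^sup>+x. ennreal (q x) * indicator {0..T} x \<partial>lborel)"
  proof (intro nn_integral_cong)
    fix x :: real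
    have "(\<lambda>y. ennreal (1 + A * x + B * y) * indicator {..<T} (x + y) * indicator {0..} y) = (\<lambda>_. 0)" if "x > T"
      using that by (auto simp: indicator_def)
    then show "(\<integral>\<^sup>+y\<in>{0..}. ennreal (1 + A * x + B * y) * indicator {..<T} (x + y) \<partial>lborel) * indicator {0..} x
        = ennreal (q x) * indicator {0..T} x"
      using inner[of x] by (cases "0 \<le> x"; cases "x \<le> T") auto
  qed
  also have "\<dots> = ennreal ((T * T - T\<^sup>2 / 2 + A * (T * T\<^sup>2 / 2 - T ^ 3 / 3) - B * (T - T) ^ 3 / 6)
      - (T * 0 - 0\<^sup>2 / 2 + A * (T * 0\<^sup>2 / 2 - 0 ^ 3 / 3) - B * (T - 0) ^ 3 / 6))"
  proof (rule nn_integral_has_integral_lebesgue')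
    show "(q has_integral (T * T - T\<^sup>2 / 2 + A * (T * T\<^sup>2 / 2 - T ^ 3 / 3) - B * (T - T) ^ 3 / 6)
      - (T * 0 - 0\<^sup>2 / 2 + A * (T * 0\<^sup>2 / 2 - 0 ^ 3 / 3) - B * (T - 0) ^ 3 / 6)) {0..T}"
      using T by (intro fundamental_theorem_of_calculus)
        (auto intro!: derivative_eq_intros simp: q_def field_simps power2_eq_square
           simp flip: has_real_derivative_iff_has_vector_derivative)
  qed (use AB in \<open>auto simp: q_def\<close>)
  also have "(T * T - T\<^sup>2 / 2 + A * (T * T\<^sup>2 / 2 - T ^ 3 / 3) - B * (T - T) ^ 3 / 6)
      - (T * 0 - 0\<^sup>2 / 2 + A * (T * 0\<^sup>2 / 2 - 0 ^ 3 / 3) - B * (T - 0) ^ 3 / 6) = T\<^sup>2 / 2 + (A + B) * T ^ 3 / 6"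
    by (simp add: field_simps power2_eq_square power3_eq_cube)
  finally show ?thesis .
qed

text \<open>With x = \<open>A |z|^2\<close> and y = \<open>B |w|^2\<close> the region becomes the
  triangle x + y < T and the density becomes \<open>1 + A x + B y\<close>. Tonelli and two
  applications of the radial formula contribute the factors \<open>pi / B\<close> and
  \<open>pi / A\<close>.\<close>

lemma nn_integral_complex_ellipsoid:
  fixes A B T :: real
  assumes AB: "A > 0" "B > 0" and T: "T \<ge> 0"
  shows "(\<integral>\<^sup>+p\<in>{p. A * (norm (fst p))\<^sup>2 + B * (norm (snd p))\<^sup>2 < T}.
            ennreal (1 + A\<^sup>2 * (norm (fst p))\<^sup>2 + B\<^sup>2 * (norm (snd p))\<^sup>2) \<partial>(lborel :: (complex \<times> complex) measure))
           = ennreal (pi\<^sup>2 / (A * B) * (T\<^sup>2 / 2 + (A + B) * T ^ 3 / 6))"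
proof -
  define h where "h x y = ennreal (1 + A * x + B * y) * indicator {..<T} (x + y)" for x y
  have h [measurable]: "(\<lambda>p. h (fst p) (snd p)) \<in> borel_measurable (borel \<Otimes>\<^sub>M borel)"
    unfolding h_def by measurable
  have h' [measurable]: "(\<lambda>p. h (u p) (v p)) \<in> borel_measurable N"
    if [measurable]: "u \<in> borel_measurable N" "v \<in> borel_measurable N" for u v and N :: "'b measure"
    unfolding h_def by measurable
  have m [measurable]: "(\<lambda>x. \<integral>\<^sup>+y\<in>{0..}. h x y \<partial>lborel) \<in> borel_measurable borel"
    by measurable
  have "(\<integral>\<^sup>+p\<in>{p. A * (norm (fst p))\<^sup>2 + B * (norm (snd p))\<^sup>2 < T}.
            ennreal (1 + A\<^sup>2 * (norm (fst p))\<^sup>2 + B\<^sup>2 * (norm (snd p))\<^sup>2) \<partial>(lborel :: (complex \<times> complex) measure))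
      = (\<integral>\<^sup>+p. h (A * (norm (fst p))\<^sup>2) (B * (norm (snd p))\<^sup>2) \<partial>(lborel \<Otimes>\<^sub>M lborel :: (complex \<times> complex) measure))"
    unfolding lborel_prod
    by (intro nn_integral_cong) (auto simp: h_def indicator_def power2_eq_square mult_ac)
  also have "\<dots> = (\<integral>\<^sup>+z. \<integral>\<^sup>+w. h (A * (norm (z :: complex))\<^sup>2) (B * (norm (w :: complex))\<^sup>2) \<partial>lborel \<partial>lborel)"
    by (subst lborel.nn_integral_fst[symmetric]) simp_all
  also have "\<dots> = (\<integral>\<^sup>+z. ennreal (pi / B) * (\<integral>\<^sup>+y\<in>{0..}. h (A * (norm (z :: complex))\<^sup>2) y \<partial>lborel) \<partial>lborel)"
    by (intro nn_integral_cong nn_integral_complex_norm_squared AB) measurable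
  also have "\<dots> = ennreal (pi / B) * (ennreal (pi / A) * (\<integral>\<^sup>+x\<in>{0..}. (\<integral>\<^sup>+y\<in>{0..}. h x y \<partial>lborel) \<partial>lborel))"
    by (subst nn_integral_cmult) (simp_all add: nn_integral_complex_norm_squared[OF AB(1) m])
  also have "\<dots> = ennreal (pi / B * (pi / A * (T\<^sup>2 / 2 + (A + B) * T ^ 3 / 6)))"
    unfolding h_def nn_integral_affine_triangle[OF less_imp_le[OF AB(1)] less_imp_le[OF AB(2)] T]
    using AB by (simp add: ennreal_mult'[symmetric] del: ennreal_plus)
  finally show ?thesis by (simp add: power2_eq_square mult_ac)
qed

text \<open>The sublevel set is the region of \<open>nn_integral_complex_ellipsoid\<close> with
  \<open>T = sqrt (2 * M) * R\<close>. As \<open>A\<^sup>2 = 1 - k\<close> and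
  \<open>B\<^sup>2 = 1 + k\<close>, the volume density is \<open>4 / M\<^sup>2\<close> times its
  integrand.\<close>

lemma emeasure_potential_sublevel:
  assumes M: "M > 0" and k: "-1 < k" "k < 1" and R: "R \<ge> 0"
  defines "A \<equiv> sqrt (1 - k)" and "B \<equiv> sqrt (1 + k)"
  shows "emeasure (riemannian_measure (tn_metric M k)) {p. tn_potential M k p < R}
           = ennreal (4 / M\<^sup>2 * (pi\<^sup>2 / (A * B) *
               ((sqrt (2 * M) * R)\<^sup>2 / 2 + (A + B) * (sqrt (2 * M) * R) ^ 3 / 6)))"
proof -
  have AB: "A > 0" "B > 0" "A\<^sup>2 = 1 - k" "B\<^sup>2 = 1 + k"
    using k by (auto simp: A_def B_def)
  define D where "D = {p :: complex \<times> complex. A * (norm (fst p))\<^sup>2 + B * (norm (snd p))\<^sup>2 < sqrt (2 * M) * R}"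
  have D: "{p. tn_potential M k p < R} = D"
    using M by (auto simp: D_def tn_potential_def A_def B_def field_simps)
  have "open D"
    unfolding D_def by (intro open_Collect_less continuous_intros)
  then have [measurable]: "D \<in> sets borel" by simp
  define F :: "complex \<times> complex \<Rightarrow> ennreal"
    where "F p = ennreal (1 + A\<^sup>2 * (norm (fst p))\<^sup>2 + B\<^sup>2 * (norm (snd p))\<^sup>2)" for p
  have [measurable]: "F \<in> borel_measurable borel"
    unfolding F_def by (intro measurable_compose[OF borel_measurable_continuous_onI measurable_ennreal] continuous_intros)
  have dens: "ennreal (sqrt (det ((\<chi> i j. tn_metric M k p (frame4 i) (frame4 j)) :: real ^ 4 ^ 4)))
      = ennreal (4 / M\<^sup>2) * F p" for p
  proof -
    have eq: "1 + (1 + k) * (norm (snd p))\<^sup>2 + (1 - k) * (norm (fst p))\<^sup>2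
        = 1 + A\<^sup>2 * (norm (fst p))\<^sup>2 + B\<^sup>2 * (norm (snd p))\<^sup>2"
      by (simp add: AB)
    show ?thesis
      unfolding F_def eq[symmetric] sqrt_det_tn_metric[OF M less_imp_le[OF k(1)] less_imp_le[OF k(2)]]
      by (rule ennreal_mult') simp
  qed
  have "emeasure (riemannian_measure (tn_metric M k)) D = (\<integral>\<^sup>+p. ennreal (4 / M\<^sup>2) * (F p * indicator D p) \<partial>lborel)"
    unfolding riemannian_measure_def dens
    by (subst emeasure_density) (auto simp: mult.assoc)
  also have "\<dots> = ennreal (4 / M\<^sup>2) * (\<integral>\<^sup>+p\<in>D. F p \<partial>lborel)"
    by (rule nn_integral_cmult) measurable
  also have "(\<integral>\<^sup>+p\<in>D. F p \<partial>lborel)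
      = ennreal (pi\<^sup>2 / (A * B) * ((sqrt (2 * M) * R)\<^sup>2 / 2 + (A + B) * (sqrt (2 * M) * R) ^ 3 / 6))"
    unfolding F_def D_def by (rule nn_integral_complex_ellipsoid) (use AB M R in auto)
  also have "ennreal (4 / M\<^sup>2) * \<dots> = ennreal (4 / M\<^sup>2 * (pi\<^sup>2 / (A * B) *
      ((sqrt (2 * M) * R)\<^sup>2 / 2 + (A + B) * (sqrt (2 * M) * R) ^ 3 / 6)))"
    by (rule ennreal_mult'[symmetric]) simp
  finally show ?thesis
    unfolding D .
qed

section \<open>Comparison of balls with sublevel sets, and the limit\<close>

lemma geodesic_ball_subset_potential_sublevel:
  assumes "M > 0" "-1 \<le> k" "k \<le> 1"
  shows "geodesic_ball (tn_metric M k) (0, 0) R \<subseteq> {p. tn_potential M k p < R}"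
proof
  fix p assume "p \<in> geodesic_ball (tn_metric M k) (0, 0) R"
  then have "ennreal (tn_potential M k p) < ennreal R"
    using geodesic_dist_ge_potential[OF assms, of p] by (auto simp: geodesic_ball_def)
  moreover have "tn_potential M k p \<ge> 0"
    using assms by (simp add: tn_potential_def)
  ultimately show "p \<in> {p. tn_potential M k p < R}"
    by (simp add: ennreal_less_iff)
qed

text \<open>The potential is a positive definite quadratic form in u and v, so on the sublevel set u
  and v are at most constants times \<open>sqrt R\<close>. \<open>C\<close> collects these constants
  with the factor of the error term in \<open>geodesic_dist_le_potential\<close>.\<close>

lemma potential_sublevel_subset_geodesic_ball:
  assumes M: "M > 0" and k: "-1 < k" "k < 1"
  obtains C where "C > 0"
    "\<And>R. R > 0 \<Longrightarrow> {p. tn_potential M k p < R - C * sqrt R} \<subseteq> geodesic_ball (tn_metric M k) (0, 0) R"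
proof
  define s where "s = sqrt (2 * M)"
  have s: "s > 0" using M by (simp add: s_def)
  define A B where "A = sqrt (1 - k)" and "B = sqrt (1 + k)"
  have AB: "A > 0" "B > 0" using k by (auto simp: A_def B_def)
  define C where "C = 2 / s * (sqrt (s / A) + sqrt (s / B))"
  show "C > 0" using s AB by (simp add: C_def add_pos_pos)
  fix R :: real assume R: "R > 0"
  show "{p. tn_potential M k p < R - C * sqrt R} \<subseteq> geodesic_ball (tn_metric M k) (0, 0) R"
  proof
    fix p assume "p \<in> {p. tn_potential M k p < R - C * sqrt R}"
    then have p: "tn_potential M k p + C * sqrt R < R" by simp
    moreover have "C * sqrt R \<ge> 0" using \<open>C > 0\<close> R by simp
    ultimately have "tn_potential M k p < R" by linarith
    then have "A * (norm (fst p))\<^sup>2 + B * (norm (snd p))\<^sup>2 < s * R"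
      using s by (simp add: tn_potential_def A_def B_def s_def field_simps)
    moreover have "A * (norm (fst p))\<^sup>2 \<ge> 0" "B * (norm (snd p))\<^sup>2 \<ge> 0" using AB by auto
    ultimately have "A * (norm (fst p))\<^sup>2 \<le> s * R" "B * (norm (snd p))\<^sup>2 \<le> s * R" by linarith+
    then have "(norm (fst p))\<^sup>2 \<le> s / A * R" "(norm (snd p))\<^sup>2 \<le> s / B * R"
      using AB by (auto simp: field_simps)
    then have "norm (fst p) \<le> sqrt (s / A) * sqrt R" "norm (snd p) \<le> sqrt (s / B) * sqrt R"
      by (auto simp flip: real_sqrt_mult intro: real_le_rsqrt)
    then have "2 / s * (norm (fst p) + norm (snd p)) \<le> 2 / s * ((sqrt (s / A) + sqrt (s / B)) * sqrt R)"
      using s by (intro mult_left_mono) (auto simp: algebra_simps)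
    also have "\<dots> = C * sqrt R"
      by (simp add: C_def)
    finally have "tn_potential M k p + 2 / s * (norm (fst p) + norm (snd p)) < R"
      using p by linarith
    with geodesic_dist_le_potential[OF assms, of p] R
    show "p \<in> geodesic_ball (tn_metric M k) (0, 0) R"
      by (auto simp: geodesic_ball_def s_def ennreal_lessI intro: le_less_trans)
  qed
qed

theorem proposition3p4:
  fixes M k :: real
  assumes "M > 0" and "-1 < k" and "k < 1"
  shows "((\<lambda>R. measure (riemannian_measure (tn_metric M k)) (geodesic_ball (tn_metric M k) (0, 0) R) / R ^ 3)
           \<longlongrightarrow> 8 / 3 * pi\<^sup>2 * (1 / sqrt (2 * M)) * (1 / sqrt (1 - k) + 1 / sqrt (1 + k))) at_top"
proof -
  let ?\<mu> = "riemannian_measure (tn_metric M k)"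
  let ?ball = "geodesic_ball (tn_metric M k) (0, 0)"
  let ?sub = "\<lambda>R. {p. tn_potential M k p < R}"
  define A B s where "A = sqrt (1 - k)" and "B = sqrt (1 + k)" and "s = sqrt (2 * M)"
  have AB: "A > 0" "B > 0" and s: "s > 0"
    using assms by (auto simp: A_def B_def s_def)
  define V where "V R = 4 / M\<^sup>2 * (pi\<^sup>2 / (A * B) * ((s * R)\<^sup>2 / 2 + (A + B) * (s * R) ^ 3 / 6))" for R
  have V: "emeasure ?\<mu> (?sub R) = ennreal (V R)" if "R \<ge> 0" for R
    using emeasure_potential_sublevel[OF assms that] by (simp add: V_def A_def B_def s_def)
  have V_nonneg: "V R \<ge> 0" if "R \<ge> 0" for R
    using AB s that by (simp add: V_def)
  obtain C where C: "C > 0" "\<And>R. R > 0 \<Longrightarrow> ?sub (R - C * sqrt R) \<subseteq> ?ball R"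
    using potential_sublevel_subset_geodesic_ball[OF assms] by blast
  have "open (?ball R)" for R
  proof (rule open_geodesic_ball)
    show "continuous_on UNIV (\<lambda>(p, X). tn_metric M k p X X)"
      using assms by (intro continuous_on_tn_metric) auto
    show "tn_metric M k p (c *\<^sub>R X) (c *\<^sub>R X) = c\<^sup>2 * tn_metric M k p X X" for p c X
      using assms by (intro tn_metric_scaleR) auto
  qed
  then have meas: "?ball R \<in> sets ?\<mu>" for R
    by (simp add: riemannian_measure_def)
  have "open (?sub R)" for R
    unfolding tn_potential_def using s by (intro open_Collect_less continuous_intros) (auto simp: s_def)
  then have meas_sub: "?sub R \<in> sets ?\<mu>" for R
    by (simp add: riemannian_measure_def)
  have ball_le: "emeasure ?\<mu> (?ball R) \<le> ennreal (V R)" if "R > 0" for R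
  proof -
    have "emeasure ?\<mu> (?ball R) \<le> emeasure ?\<mu> (?sub R)"
      using assms by (intro emeasure_mono geodesic_ball_subset_potential_sublevel meas_sub) auto
    also have "\<dots> = ennreal (V R)"
      using that by (intro V) simp
    finally show ?thesis .
  qed
  have upper: "measure ?\<mu> (?ball R) \<le> V R" if "R > 0" for R
    unfolding measure_def using ball_le[OF that] V_nonneg that by (intro enn2real_leI) auto
  have lower: "V (R - C * sqrt R) \<le> measure ?\<mu> (?ball R)" if R: "R > 0" "R - C * sqrt R \<ge> 0" for R
  proof -
    have "ennreal (V (R - C * sqrt R)) = emeasure ?\<mu> (?sub (R - C * sqrt R))"
      using V[OF R(2)] by simp
    also have "\<dots> \<le> emeasure ?\<mu> (?ball R)"
      by (rule emeasure_mono[OF C(2)[OF R(1)] meas])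
    finally have le: "ennreal (V (R - C * sqrt R)) \<le> emeasure ?\<mu> (?ball R)" .
    \<comment> \<open>Finiteness is essential: \<open>measure\<close> would turn an infinite volume
      into 0.\<close>
    have "emeasure ?\<mu> (?ball R) < \<infinity>"
      using ball_le[OF R(1)] by (rule le_less_trans) simp
    with enn2real_mono[OF le] show ?thesis
      using V_nonneg[OF R(2)] by (simp add: measure_def)
  qed
  define L where "L = 4 / M\<^sup>2 * (pi\<^sup>2 / (A * B) * ((A + B) * s ^ 3 / 6))"
  have R_inv: "((\<lambda>R::real. 1 / R) \<longlongrightarrow> 0) at_top" "((\<lambda>R::real. 1 / sqrt R) \<longlongrightarrow> 0) at_top"
    by (auto intro!: tendsto_divide_0[OF tendsto_const] filterlim_at_top_imp_at_infinity
        filterlim_ident sqrt_at_top)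
  \<comment> \<open>After factoring R out of \<open>R - c * sqrt R\<close>, the quotient by
    \<open>R ^ 3\<close> is a polynomial in \<open>1 / R\<close> and \<open>1 / sqrt R\<close>. The
    limit does not depend on c: \<open>c = C\<close> serves the lower bound and \<open>c = 0\<close>
    the upper one.\<close>
  have "((\<lambda>R. 4 / M\<^sup>2 * (pi\<^sup>2 / (A * B) * (s\<^sup>2 * (1 - c * (1 / sqrt R))\<^sup>2 * (1 / R) / 2
      + (A + B) * (s ^ 3 * (1 - c * (1 / sqrt R)) ^ 3) / 6)))
      \<longlongrightarrow> 4 / M\<^sup>2 * (pi\<^sup>2 / (A * B) * (s\<^sup>2 * (1 - c * 0)\<^sup>2 * 0 / 2 + (A + B) * (s ^ 3 * (1 - c * 0) ^ 3) / 6))) at_top"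
    for c :: real
    by (intro tendsto_intros R_inv) auto
  moreover have "\<forall>\<^sub>F R in at_top. 4 / M\<^sup>2 * (pi\<^sup>2 / (A * B) * (s\<^sup>2 * (1 - c * (1 / sqrt R))\<^sup>2 * (1 / R) / 2
      + (A + B) * (s ^ 3 * (1 - c * (1 / sqrt R)) ^ 3) / 6)) = V (R - c * sqrt R) / R ^ 3" for c
    using eventually_gt_at_top[of 0]
  proof eventually_elim
    case (elim R)
    have r: "R - c * sqrt R = R * (1 - c * (1 / sqrt R))"
      using elim by (simp add: field_simps)
    have e: "s\<^sup>2 * x\<^sup>2 * (1 / R) / 2 + (A + B) * (s ^ 3 * x ^ 3) / 6
        = ((s * (R * x))\<^sup>2 / 2 + (A + B) * (s * (R * x)) ^ 3 / 6) / R ^ 3" for x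
      using elim by (simp add: power_mult_distrib add_divide_distrib power2_eq_square power3_eq_cube mult_ac)
    show ?case
      unfolding V_def r e by simp
  qed
  ultimately have lim: "((\<lambda>R. V (R - c * sqrt R) / R ^ 3) \<longlongrightarrow> L) at_top" for c
    unfolding L_def by (auto intro: Lim_transform_eventually)
  have "L = 8 / 3 * pi\<^sup>2 * (1 / s) * (1 / A + 1 / B)"
  proof -
    \<comment> \<open>In terms of s, the factor \<open>4 / M\<^sup>2\<close> is
      \<open>16 / s ^ 4\<close>, which against \<open>s ^ 3 / 6\<close> leaves 8/3 times 1/s, while
      (A + B) / (A B) is the sum of the reciprocals.\<close>
    have M: "M = s\<^sup>2 / 2" using assms by (simp add: s_def)
    show ?thesis
      unfolding L_def M using AB s by (simp add: field_simps power2_eq_square power3_eq_cube)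
  qed
  moreover have "((\<lambda>R. measure ?\<mu> (?ball R) / R ^ 3) \<longlongrightarrow> L) at_top"
  proof (rule tendsto_sandwich[OF _ _ lim[of C] lim[of 0, simplified]])
    \<comment> \<open>From here on the reduced level \<open>R - C * sqrt R\<close> is nonnegative,
      so the volume formula applies to it.\<close>
    have "\<forall>\<^sub>F R in at_top. C\<^sup>2 \<le> R" by (rule eventually_ge_at_top)
    then show "\<forall>\<^sub>F R in at_top. V (R - C * sqrt R) / R ^ 3 \<le> measure ?\<mu> (?ball R) / R ^ 3"
      using eventually_gt_at_top[of 0]
    proof eventually_elim
      case (elim R)
      then have "C \<le> sqrt R" by (simp add: real_le_rsqrt)
      then have "C * sqrt R \<le> sqrt R * sqrt R"
        using elim by (intro mult_right_mono) auto
      then have "R - C * sqrt R \<ge> 0" using elim by simp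
      then show ?case using lower elim by (simp add: divide_right_mono)
    qed
    show "\<forall>\<^sub>F R in at_top. measure ?\<mu> (?ball R) / R ^ 3 \<le> V R / R ^ 3"
      using eventually_gt_at_top[of 0] by eventually_elim (simp add: upper divide_right_mono)
  qed
  ultimately show ?thesis
    by (simp add: A_def B_def s_def)
qed

end
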